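(* Let $\mathbf M$ be a flag matroid (equivalently, a flag $\mathbb K$-matroid) of rank $(r,r+1)$ on $E=\{1,\dots,n\}$. Then $\mathbf M$ is regular if and only if it is binary and orientable.
   Context: A tract is a commutative multiplicative monoid $F$ with identity $1$ and absorbing element $0$ such that $F^\times=F\setminus\{0\}$ is a group, together with a subset $N_F\subseteq\mathbb{N}[F^\times]$ (the nullset) such that $0\in N_F$, $1\notin N_F$, there is a unique $\epsilon\in F^\times$ with $1+\epsilon\in N_F$, and $N_F$ is stable under multiplication by $F^\times$. A tract morphism $f:F\to F'$ is multiplicative with $f(0)=0$, $f(1)=1$, $\sum f(a_i)\in N_{F'}$ whenever $\sum a_i\in N_F$. Examples: the Krasner hyperfield $\mathbb K=\{0,1\}$ with $N_{\mathbb K}=\mathbb N\setminus\{1\}$; the regular partial field $\mathbb F_1^\pm=\{0,1,\epsilon\}$ with $N=\{m\cdot1+m\cdot\epsilon: m\in\mathbb N\}$; the field $\mathbb F_2$ with $N=\{\sum a_i: \sum a_i=0\text{ in }\mathbb F_2\}$; the sign hyperfield $\mathbb S=\{0,1,-1\}$ with $\epsilon=-1$ and $N_{\mathbb S}=\{m\cdot1+m'\cdot(-1): m=m'=0\text{ or }m\neq0\neq m'\}$. For each tract $F$ there is a unique tract morphism $t_F:F\to\mathbb K$ (sending $F^\times$ to $1$). A Grassmann–Plücker function of rank $r$ on $E$ is a map $\varphi:E^r\to F$, not identically zero, alternating (swapping two arguments multiplies by $\epsilon$; $0$ if two arguments coincide), with $\sum_{k=1}^{r+1}\epsilon^k\varphi(y_1,\dots,\widehat{y_k},\dots,y_{r+1})\varphi(y_k,x_1,\dots,x_{r-1})\in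 N_F$ for all $x_i,y_j\in E$. An $F$-matroid is a class $[\varphi]$ modulo $F^\times$; push-forward $f_*[\varphi]=[f\circ\varphi]$. If $M=[\mu]$, $N=[\nu]$ have ranks $r,w$, then $N\twoheadrightarrow M$ means $\sum_{k=1}^{w+1}\epsilon^k\nu(y_1,\dots,\widehat{y_k},\dots,y_{w+1})\mu(y_k,x_1,\dots,x_{r-1})\in N_F$ for all indices. A flag $F$-matroid is a sequence $(M_1,\dots,M_s)$ with $M_j\twoheadrightarrow M_i$ for $i<j$, of rank $(\mathrm{rk}M_1,\dots,\mathrm{rk}M_s)$; $f_*(M_1,\dots,M_s)=(f_*M_1,\dots,f_*M_s)$. Usual flag matroids (sequences of matroids each a quotient of the next, i.e. flats of $M_i$ are flats of $M_{i+1}$) are identified with flag $\mathbb K$-matroids by taking underlying matroids. A flag matroid $\mathbf M$ is regular if $\mathbf M=t_{\mathbb F_1^\pm,*}\mathbf N$ for some flag $\mathbb F_1^\pm$-matroid $\mathbf N$; binary if $\mathbf M=t_{\mathbb F_2,*}\mathbf N$ for some flag $\mathbb F_2$-matroid $\mathbf N$; orientable if $\mathbf M=t_{\mathbb S,*}\mathbf N$ for some flag $\mathbb S$-matroid $\mathbf N$. *)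

theory Defs
  imports "HOL-Algebra.Group" "HOL-Library.Multiset" "HOL-Library.FuncSet" "HOL-Library.Z2"
begin

section \<open>Tracts\<close>

text \<open>Elements of \<open>\<nat>[F\<^sup>\<times>]\<close> are encoded as multisets of units of \<open>F\<close>.\<close>

record 'a tract_data = "'a monoid" +
  tzero :: 'a
  nullset :: "'a multiset set"

locale tract = comm_monoid F for F :: "('a, 'b) tract_data_scheme" (structure) +
  assumes zero_closed: "tzero F \<in> carrier F"
    and zero_absorbing: "a \<in> carrier F \<Longrightarrow> tzero F \<otimes> a = tzero F"
    and Units_eq: "Units F = carrier F - {tzero F}"
    and nullset_Units: "S \<in> nullset F \<Longrightarrow> set_mset S \<subseteq> Units F"
    and empty_nullset: "{#} \<in> nullset F"
    and one_not_nullset: "{#\<one>#} \<notin> nullset F"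
    and unique_eps: "\<exists>!e. e \<in> Units F \<and> {#\<one>, e#} \<in> nullset F"
    and nullset_stable: "a \<in> Units F \<Longrightarrow> S \<in> nullset F \<Longrightarrow> {# a \<otimes> b. b \<in># S #} \<in> nullset F"

definition eps :: "('a, 'b) tract_data_scheme \<Rightarrow> 'a" where
  "eps F = (THE e. e \<in> Units F \<and> {#\<one>\<^bsub>F\<^esub>, e#} \<in> nullset F)"

definition tract_hom :: "('a, 'c) tract_data_scheme \<Rightarrow> ('b, 'd) tract_data_scheme \<Rightarrow> ('a \<Rightarrow> 'b) set" where
  "tract_hom F F' = {f \<in> hom F F'. f (tzero F) = tzero F' \<and> f \<one>\<^bsub>F\<^esub> = \<one>\<^bsub>F'\<^esub> \<and>
     (\<forall>S \<in> nullset F. image_mset f S \<in> nullset F')}"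

text \<open>A formal sum of arbitrary elements of \<open>F\<close> lies in \<open>\<nat>[F\<^sup>\<times>]\<close> after its zero terms,
  which do not contribute, have been deleted.\<close>

definition null_sum :: "('a, 'b) tract_data_scheme \<Rightarrow> 'a multiset \<Rightarrow> bool" where
  "null_sum F S \<longleftrightarrow> {# a \<in># S. a \<noteq> tzero F #} \<in> nullset F"

definition krasner :: "nat tract_data" where
  "krasner = \<lparr>carrier = {0, 1}, monoid.mult = (*), one = 1, tzero = 0,
     nullset = {replicate_mset m 1 | m. m \<noteq> 1}\<rparr>"

definition F1pm :: "int tract_data" where
  "F1pm = \<lparr>carrier = {0, 1, -1}, monoid.mult = (*), one = 1, tzero = 0,
     nullset = {replicate_mset m 1 + replicate_mset m (-1) | m. True}\<rparr>"

definition F2 :: "bit tract_data" where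
  "F2 = \<lparr>carrier = UNIV, monoid.mult = (*), one = 1, tzero = 0,
     nullset = {S. 0 \<notin># S \<and> sum_mset S = 0}\<rparr>"

definition sign_hyperfield :: "int tract_data" where
  "sign_hyperfield = \<lparr>carrier = {0, 1, -1}, monoid.mult = (*), one = 1, tzero = 0,
     nullset = {replicate_mset m 1 + replicate_mset m' (-1) | m m'.
       (m = 0 \<and> m' = 0) \<or> (m \<noteq> 0 \<and> m' \<noteq> 0)}\<rparr>"

definition to_krasner :: "('a, 'b) tract_data_scheme \<Rightarrow> 'a \<Rightarrow> nat" where
  "to_krasner F a = (if a = tzero F then 0 else 1)"


section \<open>Matroids and flag matroids with coefficients\<close>

definition tuples :: "'e set \<Rightarrow> nat \<Rightarrow> 'e list set" where
  "tuples E r = {xs. length xs = r \<and> set xs \<subseteq> E}"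

text \<open>The relations \<open>\<Sum>\<^sub>k \<epsilon>\<^sup>k \<nu>(y\<^sub>1, \<dots>, y\<^sub>k omitted, \<dots>, y\<^sub>w\<^sub>+\<^sub>1) \<mu>(y\<^sub>k, x\<^sub>1, \<dots>, x\<^sub>r\<^sub>-\<^sub>1) \<in> N\<^sub>F\<close>.
  Positions are counted from \<open>0\<close>, hence the exponent \<open>Suc k\<close>. The condition on the length of \<open>xs\<close>
  makes the relations vacuous for \<open>r = 0\<close>, where there are no tuples \<open>(x\<^sub>1, \<dots>, x\<^sub>r\<^sub>-\<^sub>1)\<close>.\<close>

definition pluecker_relations ::
    "('a, 'b) tract_data_scheme \<Rightarrow> 'e set \<Rightarrow> nat \<Rightarrow> ('e list \<Rightarrow> 'a) \<Rightarrow> nat \<Rightarrow> ('e list \<Rightarrow> 'a) \<Rightarrow> bool" where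
  "pluecker_relations F E w \<nu> r \<mu> \<longleftrightarrow>
     (\<forall>ys \<in> tuples E (Suc w). \<forall>xs. set xs \<subseteq> E \<and> Suc (length xs) = r \<longrightarrow>
       null_sum F {# eps F [^]\<^bsub>F\<^esub> Suc k \<otimes>\<^bsub>F\<^esub> \<nu> (take k ys @ drop (Suc k) ys) \<otimes>\<^bsub>F\<^esub> \<mu> (ys ! k # xs).
                     k \<in># mset_set {0..w} #})"

definition gp_functions :: "('a, 'b) tract_data_scheme \<Rightarrow> 'e set \<Rightarrow> nat \<Rightarrow> ('e list \<Rightarrow> 'a) set" where
  "gp_functions F E r = {\<phi> \<in> tuples E r \<rightarrow>\<^sub>E carrier F.
     (\<exists>xs \<in> tuples E r. \<phi> xs \<noteq> tzero F) \<and>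
     (\<forall>xs \<in> tuples E r. \<forall>i j. i < j \<and> j < r \<longrightarrow>
        \<phi> (xs[i := xs ! j, j := xs ! i]) = eps F \<otimes>\<^bsub>F\<^esub> \<phi> xs \<and>
        (xs ! i = xs ! j \<longrightarrow> \<phi> xs = tzero F)) \<and>
     pluecker_relations F E r \<phi> r \<phi>}"

definition gp_class ::
    "('a, 'b) tract_data_scheme \<Rightarrow> 'e set \<Rightarrow> nat \<Rightarrow> ('e list \<Rightarrow> 'a) \<Rightarrow> ('e list \<Rightarrow> 'a) set" where
  "gp_class F E r \<phi> = {\<lambda>xs\<in>tuples E r. a \<otimes>\<^bsub>F\<^esub> \<phi> xs | a. a \<in> Units F}"

text \<open>A matroid with coefficients is a class of Grassmann--Pluecker functions, stored together with
  its rank.\<close>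

record ('e, 'a) coeff_matroid =
  mrank :: nat
  mclass :: "('e list \<Rightarrow> 'a) set"

definition coeff_matroids :: "('a, 'b) tract_data_scheme \<Rightarrow> 'e set \<Rightarrow> ('e, 'a) coeff_matroid set" where
  "coeff_matroids F E = {\<lparr>mrank = r, mclass = gp_class F E r \<phi>\<rparr> | r \<phi>. \<phi> \<in> gp_functions F E r}"

definition matroid_quotient ::
    "('a, 'b) tract_data_scheme \<Rightarrow> 'e set \<Rightarrow> ('e, 'a) coeff_matroid \<Rightarrow> ('e, 'a) coeff_matroid \<Rightarrow> bool" where
  "matroid_quotient F E N M \<longleftrightarrow>
     (\<forall>\<nu> \<in> mclass N. \<forall>\<mu> \<in> mclass M. pluecker_relations F E (mrank N) \<nu> (mrank M) \<mu>)"

definition push_forward ::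
    "('b, 'd) tract_data_scheme \<Rightarrow> 'e set \<Rightarrow> ('a \<Rightarrow> 'b) \<Rightarrow> ('e, 'a) coeff_matroid \<Rightarrow> ('e, 'b) coeff_matroid" where
  "push_forward F' E f M =
     \<lparr>mrank = mrank M, mclass = (\<Union>\<phi> \<in> mclass M. gp_class F' E (mrank M) (f \<circ> \<phi>))\<rparr>"

definition flag_matroid :: "('a, 'b) tract_data_scheme \<Rightarrow> 'e set \<Rightarrow> ('e, 'a) coeff_matroid list \<Rightarrow> bool" where
  "flag_matroid F E Ms \<longleftrightarrow> set Ms \<subseteq> coeff_matroids F E \<and>
     (\<forall>i j. i < j \<and> j < length Ms \<longrightarrow> matroid_quotient F E (Ms ! j) (Ms ! i))"

definition flag_rank :: "('e, 'a) coeff_matroid list \<Rightarrow> nat list" where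
  "flag_rank Ms = map mrank Ms"

definition flag_push_forward ::
    "('b, 'd) tract_data_scheme \<Rightarrow> 'e set \<Rightarrow> ('a \<Rightarrow> 'b) \<Rightarrow> ('e, 'a) coeff_matroid list \<Rightarrow> ('e, 'b) coeff_matroid list" where
  "flag_push_forward F' E f Ms = map (push_forward F' E f) Ms"

definition regular_flag :: "'e set \<Rightarrow> ('e, nat) coeff_matroid list \<Rightarrow> bool" where
  "regular_flag E M \<longleftrightarrow>
     (\<exists>N. flag_matroid F1pm E N \<and> M = flag_push_forward krasner E (to_krasner F1pm) N)"

definition binary_flag :: "'e set \<Rightarrow> ('e, nat) coeff_matroid list \<Rightarrow> bool" where
  "binary_flag E M \<longleftrightarrow>
     (\<exists>N. flag_matroid F2 E N \<and> M = flag_push_forward krasner E (to_krasner F2) N)"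

definition orientable_flag :: "'e set \<Rightarrow> ('e, nat) coeff_matroid list \<Rightarrow> bool" where
  "orientable_flag E M \<longleftrightarrow>
     (\<exists>N. flag_matroid sign_hyperfield E N \<and>
          M = flag_push_forward krasner E (to_krasner sign_hyperfield) N)"


section \<open>Basic properties\<close>

lemma Units_krasner: "Units krasner = {1}"
  by (auto simp: Units_def krasner_def)

lemma Units_F1pm: "Units F1pm = {1, -1}"
  by (auto simp: Units_def F1pm_def)

lemma Units_F2: "Units F2 = {1}"
  by (auto simp: Units_def F2_def)

lemma Units_sign_hyperfield: "Units sign_hyperfield = {1, -1}"
  by (auto simp: Units_def sign_hyperfield_def)

lemma (in tract) tract_epsI:
  assumes "e \<in> Units F" "{#\<one>, e#} \<in> nullset F"
  shows "eps F = e"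
  unfolding eps_def by (rule the1_equality[OF unique_eps]) (use assms in simp)

lemma krasner_nullset_iff: "S \<in> nullset krasner \<longleftrightarrow> set_mset S \<subseteq> {1} \<and> size S \<noteq> 1"
proof
  assume *: "set_mset S \<subseteq> {1} \<and> size S \<noteq> 1"
  then have "S = replicate_mset (size S) 1"
    by (intro set_mset_subset_singletonD) simp
  with * show "S \<in> nullset krasner" unfolding krasner_def tract_data.simps by blast
qed (auto simp: krasner_def split: if_splits)

lemma tract_krasner: "tract krasner"
proof -
  interpret comm_monoid krasner
    by unfold_locales (auto simp: krasner_def)
  show ?thesis
  proof
    show "\<exists>!e. e \<in> Units krasner \<and> {#\<one>\<^bsub>krasner\<^esub>, e#} \<in> nullset krasner"
      unfolding Units_krasner krasner_nullset_iff by (auto simp: krasner_def)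
  next
    fix a S assume "a \<in> Units krasner" "S \<in> nullset krasner"
    then show "{# a \<otimes>\<^bsub>krasner\<^esub> b. b \<in># S #} \<in> nullset krasner"
      unfolding Units_krasner krasner_nullset_iff by (auto simp: krasner_def)
  next
    show "Units krasner = carrier krasner - {tzero krasner}"
      unfolding Units_krasner by (auto simp: krasner_def)
  qed (simp_all add: krasner_nullset_iff Units_krasner, auto simp: krasner_def)
qed

lemma tract_F2: "tract F2"
proof -
  interpret comm_monoid F2
    by unfold_locales (auto simp: F2_def ac_simps)
  show ?thesis
  proof
    show "\<exists>!e. e \<in> Units F2 \<and> {#\<one>\<^bsub>F2\<^esub>, e#} \<in> nullset F2"
      unfolding Units_F2 by (auto simp: F2_def)
  next
    fix S assume "S \<in> nullset F2"
    then show "set_mset S \<subseteq> Units F2"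
      unfolding Units_F2 by (auto simp: F2_def) (metis bit_not_one_iff)
  next
    fix a S assume "a \<in> Units F2" "S \<in> nullset F2"
    then have "a = \<one>\<^bsub>F2\<^esub>" "S \<in> nullset F2" by (simp_all add: Units_F2) (simp add: F2_def)
    moreover have "{# \<one>\<^bsub>F2\<^esub> \<otimes>\<^bsub>F2\<^esub> b. b \<in># S #} = {# b. b \<in># S #}"
      by (intro image_mset_cong l_one) (simp add: F2_def)
    ultimately show "{# a \<otimes>\<^bsub>F2\<^esub> b. b \<in># S #} \<in> nullset F2" by simp
  next
    show "Units F2 = carrier F2 - {tzero F2}"
      unfolding Units_F2 by (auto simp: F2_def)
  qed (auto simp: F2_def)
qed

lemma F1pm_nullset_iff:
  "S \<in> nullset F1pm \<longleftrightarrow> set_mset S \<subseteq> {1, -1} \<and> count S 1 = count S (-1)"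
proof
  assume "set_mset S \<subseteq> {1, -1} \<and> count S 1 = count S (-1)"
  then have "S = replicate_mset (count S 1) 1 + replicate_mset (count S 1) (-1)"
    by (intro multiset_eqI) (auto simp: not_in_iff[symmetric])
  then show "S \<in> nullset F1pm" unfolding F1pm_def by auto
qed (auto simp: F1pm_def split: if_splits)

lemma sign_hyperfield_nullset_iff:
  "S \<in> nullset sign_hyperfield \<longleftrightarrow> set_mset S \<subseteq> {1, -1} \<and> (1 \<in># S \<longleftrightarrow> -1 \<in># S)"
proof
  assume *: "set_mset S \<subseteq> {1, -1} \<and> (1 \<in># S \<longleftrightarrow> -1 \<in># S)"
  then have "S = replicate_mset (count S 1) 1 + replicate_mset (count S (-1)) (-1)"
    by (intro multiset_eqI) (auto simp: not_in_iff[symmetric])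
  moreover have "count S 1 = 0 \<longleftrightarrow> count S (-1) = 0"
    using * by (simp add: count_eq_zero_iff)
  ultimately show "S \<in> nullset sign_hyperfield" unfolding sign_hyperfield_def by auto
qed (auto simp: sign_hyperfield_def split: if_splits)

lemma tract_F1pm: "tract F1pm"
proof -
  interpret comm_monoid F1pm
    by unfold_locales (auto simp: F1pm_def)
  show ?thesis
  proof
    show "\<exists>!e. e \<in> Units F1pm \<and> {#\<one>\<^bsub>F1pm\<^esub>, e#} \<in> nullset F1pm"
      unfolding Units_F1pm F1pm_nullset_iff by (auto simp: F1pm_def)
  next
    fix a S assume "a \<in> Units F1pm" "S \<in> nullset F1pm"
    then show "{# a \<otimes>\<^bsub>F1pm\<^esub> b. b \<in># S #} \<in> nullset F1pm"
      unfolding Units_F1pm by (auto simp: F1pm_def add.commute)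
  next
    show "Units F1pm = carrier F1pm - {tzero F1pm}"
      unfolding Units_F1pm by (auto simp: F1pm_def)
  qed (simp_all add: F1pm_nullset_iff Units_F1pm, auto simp: F1pm_def)
qed

lemma tract_sign_hyperfield: "tract sign_hyperfield"
proof -
  interpret comm_monoid sign_hyperfield
    by unfold_locales (auto simp: sign_hyperfield_def)
  show ?thesis
  proof
    show "\<exists>!e. e \<in> Units sign_hyperfield \<and> {#\<one>\<^bsub>sign_hyperfield\<^esub>, e#} \<in> nullset sign_hyperfield"
      unfolding Units_sign_hyperfield sign_hyperfield_nullset_iff by (auto simp: sign_hyperfield_def)
  next
    fix a S assume "a \<in> Units sign_hyperfield" "S \<in> nullset sign_hyperfield"
    then show "{# a \<otimes>\<^bsub>sign_hyperfield\<^esub> b. b \<in># S #} \<in> nullset sign_hyperfield"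
      unfolding Units_sign_hyperfield sign_hyperfield_nullset_iff
      by (auto simp: sign_hyperfield_def image_iff)
  next
    show "Units sign_hyperfield = carrier sign_hyperfield - {tzero sign_hyperfield}"
      unfolding Units_sign_hyperfield by (auto simp: sign_hyperfield_def)
  qed (simp_all add: sign_hyperfield_nullset_iff Units_sign_hyperfield, auto simp: sign_hyperfield_def)
qed

lemma eps_krasner: "eps krasner = 1"
  by (rule tract.tract_epsI[OF tract_krasner])
     (simp_all add: Units_krasner krasner_nullset_iff, simp_all add: krasner_def)

lemma eps_F1pm: "eps F1pm = -1"
  by (rule tract.tract_epsI[OF tract_F1pm])
     (simp_all add: Units_F1pm F1pm_nullset_iff, simp_all add: F1pm_def)

lemma eps_F2: "eps F2 = 1"
  by (rule tract.tract_epsI[OF tract_F2]) (unfold Units_F2, auto simp: F2_def)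

lemma eps_sign_hyperfield: "eps sign_hyperfield = -1"
  by (rule tract.tract_epsI[OF tract_sign_hyperfield])
     (simp_all add: Units_sign_hyperfield sign_hyperfield_nullset_iff, simp_all add: sign_hyperfield_def)

context tract
begin

lemma to_krasner_hom: "to_krasner F \<in> tract_hom F krasner"
proof -
  have one: "\<one> \<noteq> tzero F" using Units_one_closed Units_eq by auto
  have mult: "to_krasner F (a \<otimes> b) = to_krasner F a * to_krasner F b"
    if "a \<in> carrier F" "b \<in> carrier F" for a b
  proof (cases "a = tzero F \<or> b = tzero F")
    case True
    then show ?thesis
      using that zero_absorbing m_comm[of a b] zero_closed by (auto simp: to_krasner_def)
  next
    case False
    then have "a \<otimes> b \<in> Units F" using that Units_eq by (intro Units_m_closed) auto
    then show ?thesis using False Units_eq by (auto simp: to_krasner_def)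
  qed
  have null: "image_mset (to_krasner F) S \<in> nullset krasner" if S: "S \<in> nullset F" for S
  proof -
    have "image_mset (to_krasner F) S = image_mset (\<lambda>_. 1) S"
      using nullset_Units[OF S] Units_eq by (intro image_mset_cong) (auto simp: to_krasner_def)
    then have eq: "image_mset (to_krasner F) S = replicate_mset (size S) 1"
      by (simp add: image_mset_const_eq)
    have "size S \<noteq> 1"
    proof
      assume "size S = 1"
      then obtain a where a: "S = {#a#}" using size_1_singleton_mset by blast
      then have aU: "a \<in> Units F" using nullset_Units[OF S] by simp
      then have "{# inv a \<otimes> b. b \<in># S #} \<in> nullset F"
        using S by (intro nullset_stable) auto
      then show False using one_not_nullset a aU by simp
    qed
    then show ?thesis unfolding eq krasner_def by auto
  qed
  show ?thesis
    unfolding tract_hom_def hom_def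
    using mult null one by (auto simp: to_krasner_def krasner_def)
qed

lemma to_krasner_unique:
  assumes f: "f \<in> tract_hom F krasner" and a: "a \<in> carrier F"
  shows "f a = to_krasner F a"
proof (cases "a = tzero F")
  case False
  then have aU: "a \<in> Units F" using a Units_eq by simp
  have "f (a \<otimes> inv a) = f a * f (inv a)"
    using f a Units_inv_closed[OF aU] unfolding tract_hom_def hom_def krasner_def by simp
  moreover have "f (a \<otimes> inv a) = 1"
    using f aU by (simp add: tract_hom_def krasner_def)
  ultimately have "f a = 1" by simp
  then show ?thesis using False by (simp add: to_krasner_def)
qed (use f in \<open>auto simp: tract_hom_def krasner_def to_krasner_def\<close>)

lemma gp_class_scale:
  assumes a: "a \<in> Units F" and \<phi>: "\<And>xs. xs \<in> tuples E r \<Longrightarrow> \<phi> xs \<in> carrier F"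
    and \<psi>: "\<And>xs. xs \<in> tuples E r \<Longrightarrow> \<psi> xs = a \<otimes> \<phi> xs"
  shows "gp_class F E r \<psi> = gp_class F E r \<phi>"
proof -
  have "(\<lambda>xs\<in>tuples E r. b \<otimes> \<psi> xs) = (\<lambda>xs\<in>tuples E r. (b \<otimes> a) \<otimes> \<phi> xs)" if "b \<in> Units F" for b
    using that a \<phi> \<psi> by (intro restrict_ext) (simp add: m_assoc Units_closed)
  moreover have "(\<lambda>xs\<in>tuples E r. b \<otimes> \<phi> xs) = (\<lambda>xs\<in>tuples E r. (b \<otimes> inv a) \<otimes> \<psi> xs)"
    if "b \<in> Units F" for b
  proof (intro restrict_ext)
    fix xs assume xs: "xs \<in> tuples E r"
    have "b \<otimes> inv a \<otimes> (a \<otimes> \<phi> xs) = b \<otimes> ((inv a \<otimes> a) \<otimes> \<phi> xs)"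
      using that a \<phi>[OF xs] by (simp only: m_assoc Units_closed Units_inv_closed m_closed)
    then show "b \<otimes> \<phi> xs = b \<otimes> inv a \<otimes> \<psi> xs"
      using that a \<phi>[OF xs] \<psi>[OF xs] by simp
  qed
  ultimately show ?thesis
    unfolding gp_class_def using a by (blast intro: Units_m_closed Units_inv_Units)
qed

lemma push_forward_class:
  assumes "tract F'" and f: "f \<in> tract_hom F F'" and \<phi>: "\<phi> \<in> gp_functions F E r"
  shows "push_forward F' E f \<lparr>mrank = r, mclass = gp_class F E r \<phi>\<rparr> =
         \<lparr>mrank = r, mclass = gp_class F' E r (f \<circ> \<phi>)\<rparr>"
proof -
  interpret F': tract F' by fact
  have \<phi>c: "\<phi> xs \<in> carrier F" if "xs \<in> tuples E r" for xs
    using \<phi> that by (auto simp: gp_functions_def)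
  have fc: "f a \<in> carrier F'" if "a \<in> carrier F" for a
    using f that by (auto simp: tract_hom_def hom_def)
  have fm: "f (a \<otimes> b) = f a \<otimes>\<^bsub>F'\<^esub> f b" if "a \<in> carrier F" "b \<in> carrier F" for a b
    using f that by (auto simp: tract_hom_def hom_def)
  have fU: "f a \<in> Units F'" if "a \<in> Units F" for a
  proof -
    have "f (inv a) \<otimes>\<^bsub>F'\<^esub> f a = \<one>\<^bsub>F'\<^esub>" "f a \<otimes>\<^bsub>F'\<^esub> f (inv a) = \<one>\<^bsub>F'\<^esub>"
      using that f fm[of "inv a" a] fm[of a "inv a"] by (auto simp: tract_hom_def Units_closed)
    then show ?thesis using that fc unfolding Units_def[of F'] by (auto simp: Units_closed)
  qed
  have eq: "gp_class F' E r (f \<circ> \<psi>) = gp_class F' E r (f \<circ> \<phi>)" if \<psi>: "\<psi> \<in> gp_class F E r \<phi>" for \<psi>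
  proof -
    obtain a where a: "a \<in> Units F" "\<psi> = (\<lambda>xs\<in>tuples E r. a \<otimes> \<phi> xs)"
      using \<psi> by (auto simp: gp_class_def)
    show ?thesis
    proof (rule F'.gp_class_scale[OF fU[OF a(1)]])
      fix xs assume xs: "xs \<in> tuples E r"
      show "(f \<circ> \<phi>) xs \<in> carrier F'" using fc \<phi>c[OF xs] by simp
      show "(f \<circ> \<psi>) xs = f a \<otimes>\<^bsub>F'\<^esub> (f \<circ> \<phi>) xs"
        using a xs fm[OF _ \<phi>c[OF xs]] by (simp add: Units_closed)
    qed
  qed
  have "gp_class F E r \<phi> \<noteq> {}" unfolding gp_class_def using Units_one_closed by auto
  then show ?thesis unfolding push_forward_def by (simp add: eq)
qed

end

end

theory Submission
  imports Defs "Jordan_Normal_Form.Determinant"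
begin

text \<open>
  A Grassmann--Pluecker function over \<open>F1pm\<close> is a \<open>{0, 1, -1}\<close>-valued function whose Pluecker sums vanish
  over the integers. If a flag is binary and orientable, take sign-valued functions \<open>\<nu>\<close>, \<open>\<mu>\<close> of
  ranks \<open>r + 1\<close>, \<open>r\<close> orienting it. A Pluecker sum with at most three nonzero terms then has an even
  number of nonzero terms and both signs, so it is zero over the integers.

  These short relations already force all of them: for a tuple \<open>B\<close> with \<open>s = \<nu>(B) \<noteq> 0\<close>
  put \<open>A(x) = (s \<nu>(B[i := x]))\<^sub>i\<close> and \<open>v = (s (-1)\<^sup>i \<mu>(B without B\<^sub>i))\<^sub>i\<close>. An induction on the distance
  from \<open>B\<close> in the short relations shows \<open>\<nu>(x\<^sub>0, \<dots>, x\<^sub>r) = s det(A(x\<^sub>0), \<dots>, A(x\<^sub>r))\<close> and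
  \<open>\<mu>(x\<^sub>1, \<dots>, x\<^sub>r) = s det(v, A(x\<^sub>1), \<dots>, A(x\<^sub>r))\<close>, that is, \<open>\<nu>\<close> and \<open>\<mu>\<close> are the deletion and the
  contraction of \<open>v\<close> in one matroid represented over the integers, and determinants satisfy all
  Pluecker relations.
  Conversely, \<open>F1pm\<close> maps to both \<open>F2\<close> and the sign hyperfield.
\<close>

section \<open>Alternating functions on tuples\<close>

abbreviation omit :: "nat \<Rightarrow> 'a list \<Rightarrow> 'a list" where
  "omit k ys \<equiv> take k ys @ drop (Suc k) ys"

lemma nth_omit: "k < length ys \<Longrightarrow> Suc i < length ys \<Longrightarrow> omit k ys ! i = ys ! insert_index k i"
  by (auto simp: nth_append min_def insert_index_def)

lemma mset_omit: "k < length ys \<Longrightarrow> mset ys = add_mset (ys ! k) (mset (omit k ys))"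
  by (metis id_take_nth_drop mset.simps(2) mset_append union_mset_add_mset_right)

lemma mset_eq_omit:
  assumes "distinct xs" "distinct B" "set xs \<subseteq> set B" "Suc (length xs) = length B"
  obtains i where "i < length B" "mset (omit i B) = mset xs"
proof -
  have "card (set B - set xs) = 1"
    using assms by (simp add: card_Diff_subset flip: distinct_card)
  then obtain b where b: "set B - set xs = {b}" by (rule card_1_singletonE)
  then obtain i where i: "i < length B" "B ! i = b" by (metis DiffD1 in_set_conv_nth singletonI)
  have "set B = set (b # xs)" "distinct (b # xs)" using assms(1,3) b by auto
  then have "mset B = mset (b # xs)" using assms(2) set_eq_iff_mset_eq_distinct by blast
  then show thesis using that i mset_omit[OF i(1)] by simp
qed

lemma mset_eq_list_update:
  assumes "distinct xs" "distinct B" "length xs = length B" "xs \<noteq> []" "card (set xs - set B) \<le> 1"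
  obtains i x where "i < length B" "x \<in> set xs" "mset (B[i := x]) = mset xs"
proof -
  obtain x where x: "x \<in> set xs" "set xs - set B \<subseteq> {x}"
  proof (cases "set xs \<subseteq> set B")
    case True
    then show thesis using assms(4) that[of "hd xs"] by auto
  next
    case False
    then obtain x where "x \<in> set xs - set B" by blast
    moreover have "y = x" if "y \<in> set xs - set B" for y
      using assms(5) calculation that card_le_Suc0_iff_eq[of "set xs - set B"] by auto
    ultimately show thesis using that by blast
  qed
  have "set (remove1 x xs) \<subseteq> set B" "Suc (length (remove1 x xs)) = length B"
    using assms(1,3) x length_pos_if_in_set[OF x(1)] by (auto simp: length_remove1)
  then obtain i where i: "i < length B" "mset (omit i B) = mset (remove1 x xs)"
    using mset_eq_omit assms(1,2) distinct_remove1 by metis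
  then have "mset (B[i := x]) = mset xs"
    using mset_omit[OF i(1)] x(1) by (simp add: mset_update)
  then show thesis using that i(1) x(1) by blast
qed

lemma mset_eq_two_outside:
  assumes "2 \<le> card (set J - S)"
  obtains a b xs where "a \<in> set J - S" "b \<in> set J - S" "mset (a # b # xs) = mset J"
proof -
  obtain T where "T \<subseteq> set J - S" "card T = 2" using assms by (rule obtain_subset_with_card_n)
  then obtain a b where ab: "a \<in> set J - S" "b \<in> set J - S" "a \<noteq> b" by (auto simp: card_2_iff)
  then have "b \<in> set (remove1 a J)" by simp
  then have "mset (a # b # remove1 b (remove1 a J)) = mset J"
    using ab(1) by (metis DiffD1 insert_DiffM mset.simps(2) mset_remove1 set_mset_mset)
  then show thesis using that ab by blast
qed

lemma tuples_mset_cong: "mset xs = mset ys \<Longrightarrow> xs \<in> tuples E m \<longleftrightarrow> ys \<in> tuples E m"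
  unfolding tuples_def by (auto dest: mset_eq_setD mset_eq_length)

lemma omit_in_tuples: "k \<le> m \<Longrightarrow> ys \<in> tuples E (Suc m) \<Longrightarrow> omit k ys \<in> tuples E m"
  by (auto simp: tuples_def dest: in_set_takeD in_set_dropD)

lemma nth_Cons_in_tuples:
  "ys \<in> tuples E w \<Longrightarrow> k < w \<Longrightarrow> set xs \<subseteq> E \<Longrightarrow> Suc (length xs) = r \<Longrightarrow> ys ! k # xs \<in> tuples E r"
  using nth_mem[of k ys] by (auto simp: tuples_def)

lemma list_update_in_tuples: "xs \<in> tuples E m \<Longrightarrow> x \<in> E \<Longrightarrow> xs[i := x] \<in> tuples E m"
  using set_update_subset_insert[of xs i x] by (auto simp: tuples_def)

definition alternating :: "'e set \<Rightarrow> nat \<Rightarrow> ('e list \<Rightarrow> 'a::comm_ring_1) \<Rightarrow> bool" where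
  "alternating E m \<phi> \<longleftrightarrow> (\<forall>xs \<in> tuples E m. \<forall>i j. i < j \<and> j < m \<longrightarrow>
     \<phi> (xs[i := xs ! j, j := xs ! i]) = - \<phi> xs \<and> (xs ! i = xs ! j \<longrightarrow> \<phi> xs = 0))"

lemma alternating_swap:
  assumes "alternating E m \<phi>" "xs \<in> tuples E m" "i < m" "j < m" "i \<noteq> j"
  shows "\<phi> (xs[i := xs ! j, j := xs ! i]) = - \<phi> xs"
proof (cases "i < j")
  case False
  then have "j < i" using assms(5) by simp
  then have "\<phi> (xs[j := xs ! i, i := xs ! j]) = - \<phi> xs"
    using assms unfolding alternating_def by blast
  then show ?thesis using assms(5) by (simp add: list_update_swap)
qed (use assms in \<open>auto simp: alternating_def\<close>)

lemma alternating_not_distinct: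
  assumes "alternating E m \<phi>" "xs \<in> tuples E m" "\<not> distinct xs"
  shows "\<phi> xs = 0"
proof -
  obtain i j where "i < length xs" "j < length xs" "i \<noteq> j" "xs ! i = xs ! j"
    using assms(3) by (auto simp: distinct_conv_nth)
  then show ?thesis
    using assms(1,2) unfolding alternating_def tuples_def
    by (cases i j rule: linorder_cases) (fastforce, simp, fastforce)
qed

lemma alternating_permute_list:
  assumes alt: "alternating E m \<phi>" and "p permutes {..<m}" "xs \<in> tuples E m"
  shows "\<phi> (permute_list p xs) = of_int (sign p) * \<phi> xs"
  using assms(2) finite_lessThan assms(3)
proof (induction p arbitrary: xs rule: permutes_induct)
  case (swap a b p)
  let ?t = "Transposition.transpose a b"
  have len: "length xs = m" using swap.prems by (simp add: tuples_def)
  have perm: "?t permutes {..<length xs}"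
    using swap.hyps len by (intro permutes_swap_id) auto
  have transposed: "permute_list ?t xs = xs[a := xs ! b, b := xs ! a]"
    using swap.hyps len by (intro nth_equalityI)
      (auto simp: permute_list_nth[OF perm] nth_list_update transpose_def)
  have "permute_list (?t \<circ> p) xs = permute_list p (permute_list ?t xs)"
    using swap.hyps len by (intro permute_list_compose) auto
  also have "\<phi> \<dots> = of_int (sign p) * \<phi> (permute_list ?t xs)"
    using swap.prems tuples_mset_cong[OF mset_permute_list[OF perm]] by (intro swap.IH) simp
  also have "\<dots> = - (of_int (sign p) * \<phi> xs)"
    unfolding transposed using alternating_swap[OF alt swap.prems, of a b] swap.hyps by simp
  also have "\<dots> = of_int (sign (?t \<circ> p)) * \<phi> xs"
    using swap.hyps permutes_imp_permutation[OF finite_lessThan, of p m]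
    by (simp add: sign_compose sign_swap_id permutation_swap_id)
  finally show ?case .
qed simp

lemma alternating_mset_eq_sign:
  assumes "xs \<in> tuples E m" "mset xs = mset ys"
  obtains p :: "nat \<Rightarrow> nat"
  where "\<And>\<phi>::'e list \<Rightarrow> 'a::comm_ring_1. alternating E m \<phi> \<Longrightarrow> \<phi> ys = of_int (sign p) * \<phi> xs"
proof -
  obtain p where p: "p permutes {..<length xs}" "permute_list p xs = ys"
    using mset_eq_permutation[OF assms(2)[symmetric]] by metis
  show thesis
  proof (rule that)
    fix \<phi> :: "'e list \<Rightarrow> 'a" assume "alternating E m \<phi>"
    then show "\<phi> ys = of_int (sign p) * \<phi> xs"
      using alternating_permute_list[of E m \<phi> p xs] assms(1) p by (simp add: tuples_def)
  qed
qed

lemma alternating_mset_eq: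
  fixes \<phi> \<psi> :: "'e list \<Rightarrow> 'a::comm_ring_1"
  assumes "alternating E m \<phi>" "alternating E m \<psi>" "xs \<in> tuples E m" "mset xs = mset ys" "\<phi> xs = \<psi> xs"
  shows "\<phi> ys = \<psi> ys"
  using alternating_mset_eq_sign[OF assms(3,4)] assms(1,2,5) by metis

lemma alternating_mset_nonzero:
  assumes "alternating E m \<phi>" "xs \<in> tuples E m" "mset xs = mset ys" "\<phi> xs \<noteq> 0"
  shows "\<phi> ys \<noteq> 0"
proof -
  obtain p :: "nat \<Rightarrow> nat" where "\<phi> ys = of_int (sign p) * \<phi> xs"
    using alternating_mset_eq_sign[OF assms(2,3)] assms(1) by metis
  then show ?thesis using assms(4) by (cases p rule: sign_cases) simp_all
qed

section \<open>Pluecker relations over a ring\<close>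

definition gp_terms :: "('e list \<Rightarrow> 'a::comm_ring_1) \<Rightarrow> ('e list \<Rightarrow> 'a) \<Rightarrow> 'e list \<Rightarrow> 'e list \<Rightarrow> 'a multiset" where
  "gp_terms \<nu> \<mu> ys xs = mset (map (\<lambda>k. (-1) ^ Suc k * \<nu> (omit k ys) * \<mu> (ys ! k # xs)) [0..<length ys])"

definition gp_relations ::
    "('a multiset \<Rightarrow> bool) \<Rightarrow> 'e set \<Rightarrow> nat \<Rightarrow> ('e list \<Rightarrow> 'a::comm_ring_1) \<Rightarrow> nat \<Rightarrow> ('e list \<Rightarrow> 'a) \<Rightarrow> bool" where
  "gp_relations P E w \<nu> r \<mu> \<longleftrightarrow> (\<forall>ys \<in> tuples E (Suc w). \<forall>xs. set xs \<subseteq> E \<and> Suc (length xs) = r \<longrightarrow>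
     P (gp_terms \<nu> \<mu> ys xs))"

lemma gp_terms_Cons:
  "gp_terms \<nu> \<mu> (y # ys) xs =
    add_mset (- \<nu> ys * \<mu> (y # xs)) (image_mset uminus (gp_terms (\<lambda>zs. \<nu> (y # zs)) \<mu> ys xs))"
  unfolding gp_terms_def
  by (simp add: upt_conv_Cons map_Suc_upt[symmetric] multiset.map_comp o_def del: upt_Suc map_Suc_upt)

lemma gp_terms_zero:
  assumes "\<forall>y\<in>set ys. \<mu> (y # xs) = 0" "t \<in># gp_terms \<nu> \<mu> ys xs"
  shows "t = 0"
  using assms by (auto simp: gp_terms_def)

lemma sum_gp_terms:
  "sum_mset (gp_terms \<nu> \<mu> ys xs) = (\<Sum>k<length ys. (-1) ^ Suc k * \<nu> (omit k ys) * \<mu> (ys ! k # xs))"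
  by (simp add: gp_terms_def sum_mset_sum_list sum_unfold_sum_mset atLeast0LessThan)

lemma sum_mset_negf: "(\<Sum>x\<in>#S. - f x) = - (\<Sum>x\<in>#S. f x :: 'a::ab_group_add)"
  by (induction S) simp_all

lemma sum_gp_terms_append:
  assumes "\<forall>u\<in>set us. \<mu> (u # xs) = 0"
  shows "sum_mset (gp_terms \<nu> \<mu> (us @ ys) xs) =
    (-1) ^ length us * sum_mset (gp_terms (\<lambda>zs. \<nu> (us @ zs)) \<mu> ys xs)"
  using assms by (induction us arbitrary: \<nu>) (simp_all add: gp_terms_Cons sum_mset_negf)

lemma gp_terms_cong:
  assumes "ys \<in> tuples E (Suc w)" "set xs \<subseteq> E" "Suc (length xs) = r"
    and "\<And>zs. zs \<in> tuples E w \<Longrightarrow> \<nu> zs = \<nu>' zs" "\<And>zs. zs \<in> tuples E r \<Longrightarrow> \<mu> zs = \<mu>' zs"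
  shows "gp_terms \<nu> \<mu> ys xs = gp_terms \<nu>' \<mu>' ys xs"
proof -
  have "\<nu> (omit k ys) = \<nu>' (omit k ys)" "\<mu> (ys ! k # xs) = \<mu>' (ys ! k # xs)" if "k < length ys" for k
  proof -
    have "k < Suc w" using that assms(1) by (simp add: tuples_def)
    then show "\<nu> (omit k ys) = \<nu>' (omit k ys)" "\<mu> (ys ! k # xs) = \<mu>' (ys ! k # xs)"
      using assms(1-3) by (auto intro!: assms(4,5) omit_in_tuples nth_Cons_in_tuples)
  qed
  then show ?thesis unfolding gp_terms_def by (intro arg_cong[where f = mset] map_cong) simp_all
qed

lemma gp_relations_cong:
  assumes "gp_relations P E w \<nu> r \<mu>"
    and "\<And>zs. zs \<in> tuples E w \<Longrightarrow> \<nu> zs = \<nu>' zs" "\<And>zs. zs \<in> tuples E r \<Longrightarrow> \<mu> zs = \<mu>' zs"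
  shows "gp_relations P E w \<nu>' r \<mu>'"
  unfolding gp_relations_def
proof (intro ballI allI impI)
  fix ys xs assume "ys \<in> tuples E (Suc w)" "set xs \<subseteq> E \<and> Suc (length xs) = r"
  then show "P (gp_terms \<nu>' \<mu>' ys xs)"
    using assms(1) gp_terms_cong[of ys E w xs r \<nu> \<nu>' \<mu> \<mu>', OF _ _ _ assms(2,3)]
    unfolding gp_relations_def by metis
qed

abbreviation strong_gp :: "'e set \<Rightarrow> nat \<Rightarrow> ('e list \<Rightarrow> 'a::comm_ring_1) \<Rightarrow> nat \<Rightarrow> ('e list \<Rightarrow> 'a) \<Rightarrow> bool" where
  "strong_gp \<equiv> gp_relations (\<lambda>S. sum_mset S = 0)"

definition weakly_null :: "'a::comm_monoid_add multiset \<Rightarrow> bool" where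
  "weakly_null S \<longleftrightarrow> (size {# t \<in># S. t \<noteq> 0 #} \<le> 3 \<longrightarrow> sum_mset S = 0)"

abbreviation weak_gp :: "'e set \<Rightarrow> nat \<Rightarrow> ('e list \<Rightarrow> 'a::comm_ring_1) \<Rightarrow> nat \<Rightarrow> ('e list \<Rightarrow> 'a) \<Rightarrow> bool" where
  "weak_gp \<equiv> gp_relations weakly_null"

lemma strong_gp_imp_weak_gp: "strong_gp E w \<nu> r \<mu> \<Longrightarrow> weak_gp E w \<nu> r \<mu>"
  unfolding gp_relations_def weakly_null_def by blast

lemma weakly_null_add_zeros:
  assumes "weakly_null (M + N)" "\<forall>t\<in>#N. t = 0" "size M \<le> 3"
  shows "sum_mset M = 0"
proof -
  have "size {# t \<in># N. t \<noteq> 0 #} = 0" using assms(2) by (auto simp: multiset_eq_iff not_in_iff)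
  then have "size {# t \<in># M + N. t \<noteq> 0 #} \<le> 3"
    using size_filter_mset_lesseq[of "\<lambda>t. t \<noteq> 0" M] assms(3)
    by (simp only: filter_union_mset size_union)
  moreover have "sum_mset N = 0" using assms(2) by (simp add: sum_mset.neutral)
  ultimately show ?thesis using assms(1) by (simp add: weakly_null_def)
qed

lemma weak_gp_three_term:
  assumes gp: "weak_gp E w \<nu> r \<mu>" and alt: "alternating E r \<mu>"
    and ys: "a # c # d # ys \<in> tuples E (Suc w)"
    and xs: "set xs \<subseteq> E" "Suc (length xs) = r" "set ys \<subseteq> set xs"
  shows "\<nu> (c # d # ys) * \<mu> (a # xs) = \<nu> (a # d # ys) * \<mu> (c # xs) - \<nu> (a # c # ys) * \<mu> (d # xs)"
proof -
  define rest where "rest = image_mset uminus (image_mset uminus (image_mset uminus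
    (gp_terms (\<lambda>zs. \<nu> (a # c # d # zs)) \<mu> ys xs)))"
  have terms: "gp_terms \<nu> \<mu> (a # c # d # ys) xs =
      {# - \<nu> (c # d # ys) * \<mu> (a # xs), \<nu> (a # d # ys) * \<mu> (c # xs), - \<nu> (a # c # ys) * \<mu> (d # xs) #} + rest"
    by (simp add: gp_terms_Cons rest_def)
  have "\<forall>y\<in>set ys. \<mu> (y # xs) = 0"
    using ys xs by (intro ballI alternating_not_distinct[OF alt]) (auto simp: tuples_def)
  then have "\<forall>t\<in>#rest. t = 0" by (auto simp: rest_def dest: gp_terms_zero)
  moreover have "weakly_null (gp_terms \<nu> \<mu> (a # c # d # ys) xs)"
    using gp ys xs unfolding gp_relations_def by blast
  ultimately have "sum_mset {# - \<nu> (c # d # ys) * \<mu> (a # xs), \<nu> (a # d # ys) * \<mu> (c # xs),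
      - \<nu> (a # c # ys) * \<mu> (d # xs) #} = 0"
    unfolding terms by (intro weakly_null_add_zeros) simp_all
  then show ?thesis by (simp add: algebra_simps)
qed

lemma weak_gp_three_term_eq:
  fixes \<nu> \<nu>' \<mu> \<mu>' :: "'e list \<Rightarrow> 'a::idom"
  assumes "weak_gp E w \<nu> r \<mu>" "alternating E r \<mu>" "weak_gp E w \<nu>' r \<mu>'" "alternating E r \<mu>'"
    and "a # c # d # ys \<in> tuples E (Suc w)" "set xs \<subseteq> E" "Suc (length xs) = r" "set ys \<subseteq> set xs"
    and "\<nu> (c # d # ys) \<noteq> 0" "\<nu> (c # d # ys) = \<nu>' (c # d # ys)"
    and "\<nu> (a # d # ys) = \<nu>' (a # d # ys)" "\<nu> (a # c # ys) = \<nu>' (a # c # ys)"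
    and "\<mu> (c # xs) = \<mu>' (c # xs)" "\<mu> (d # xs) = \<mu>' (d # xs)"
  shows "\<mu> (a # xs) = \<mu>' (a # xs)"
proof -
  have "\<nu> (c # d # ys) * \<mu> (a # xs) = \<nu> (c # d # ys) * \<mu>' (a # xs)"
    using weak_gp_three_term[OF assms(1,2,5-8)] weak_gp_three_term[OF assms(3,4,5-8)] assms(10-)
    by simp
  then show ?thesis using assms(9) by simp
qed

lemma weak_gp_exchange:
  fixes \<nu> \<mu> :: "'e list \<Rightarrow> 'a::idom"
  assumes gp: "weak_gp E w \<nu> r \<mu>" and B: "B \<in> tuples E w" "\<nu> B \<noteq> 0"
    and x: "x # xs \<in> tuples E r" "\<mu> (x # xs) \<noteq> 0"
  shows "\<exists>i<w. \<nu> (x # omit i B) \<noteq> 0 \<and> \<mu> (B ! i # xs) \<noteq> 0"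
proof (rule ccontr)
  assume "\<not> ?thesis"
  then have "\<nu> (x # omit i B) = 0 \<or> \<mu> (B ! i # xs) = 0" if "i < length B" for i
    using that B(1) by (auto simp: tuples_def)
  then have "\<forall>t\<in>#image_mset uminus (gp_terms (\<lambda>zs. \<nu> (x # zs)) \<mu> B xs). t = 0"
    by (auto simp: gp_terms_def)
  moreover have "weakly_null (gp_terms \<nu> \<mu> (x # B) xs)"
    using gp x B unfolding gp_relations_def by (auto simp: tuples_def)
  then have "weakly_null ({#- \<nu> B * \<mu> (x # xs)#} + image_mset uminus (gp_terms (\<lambda>zs. \<nu> (x # zs)) \<mu> B xs))"
    by (simp add: gp_terms_Cons)
  ultimately have "- \<nu> B * \<mu> (x # xs) = 0"
    using weakly_null_add_zeros[of "{#- \<nu> B * \<mu> (x # xs)#}"] by simp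
  then show False using B(2) x(2) by simp
qed

text \<open>The exchange that brings \<open>x\<close> into a basis removes no other element of \<open>J\<close>, since \<open>\<mu>\<close> vanishes
  on tuples with repetitions.\<close>

lemma weak_gp_basis_between:
  fixes \<nu> \<mu> :: "'e list \<Rightarrow> 'a::idom"
  assumes gp: "weak_gp E w \<nu> r \<mu>" and alt: "alternating E r \<mu>"
    and J: "J \<in> tuples E r" "\<mu> J \<noteq> 0" and B: "B \<in> tuples E w" "\<nu> B \<noteq> 0" and T: "T \<subseteq> set J"
  shows "\<exists>B' \<in> tuples E w. \<nu> B' \<noteq> 0 \<and> T \<subseteq> set B' \<and> set B' \<subseteq> set B \<union> T"
  using finite_subset[OF T finite_set] T
proof (induction T rule: finite_subset_induct')
  case empty
  then show ?case using B by auto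
next
  case (insert x T)
  then obtain B' where B': "B' \<in> tuples E w" "\<nu> B' \<noteq> 0" "T \<subseteq> set B'" "set B' \<subseteq> set B \<union> T" by blast
  define xs where "xs = remove1 x J"
  have J_eq: "mset J = mset (x # xs)" using insert.hyps by (simp add: xs_def)
  have xxs: "x # xs \<in> tuples E r" "\<mu> (x # xs) \<noteq> 0"
    using J tuples_mset_cong[OF J_eq] alternating_mset_nonzero[OF alt _ J_eq] by blast+
  obtain i where i: "i < w" "\<nu> (x # omit i B') \<noteq> 0" "\<mu> (B' ! i # xs) \<noteq> 0"
    using weak_gp_exchange[OF gp B'(1,2) xxs] by blast
  have "B' ! i # xs \<in> tuples E r"
    using xxs(1) B'(1) i(1) by (intro nth_Cons_in_tuples) (auto simp: tuples_def)
  then have "B' ! i \<notin> set xs"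
    using alternating_not_distinct[OF alt] i(3) by auto
  moreover have "T \<subseteq> set xs" using insert.hyps mset_eq_setD[OF J_eq] by auto
  moreover have "set B' = insert (B' ! i) (set (omit i B'))"
    using mset_eq_setD[of B' "B' ! i # omit i B'"] mset_omit[of i B'] i(1) B'(1) by (simp add: tuples_def)
  ultimately have "T \<subseteq> set (omit i B')" "set (omit i B') \<subseteq> set B \<union> T"
    using B'(3,4) by (metis in_mono subset_insert, metis insert_subset)
  moreover have "x # omit i B' \<in> tuples E w"
    using xxs(1) B'(1) i(1) omit_in_tuples[of i "w - 1" B' E] by (auto simp: tuples_def)
  ultimately show ?case using i(2) by (intro bexI[of _ "x # omit i B'"]) auto
qed

lemma weak_gp_complete_to_basis:
  fixes \<nu> \<mu> :: "'e list \<Rightarrow> 'a::idom"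
  assumes gp: "weak_gp E w \<nu> r \<mu>" and alt: "alternating E w \<nu>" "alternating E r \<mu>"
    and J: "J \<in> tuples E r" "\<mu> J \<noteq> 0" and B: "B \<in> tuples E w" "\<nu> B \<noteq> 0"
    and xs: "distinct xs" "set xs \<subseteq> set J"
  obtains cs where "set cs \<subseteq> set B" "cs @ xs \<in> tuples E w" "\<nu> (cs @ xs) \<noteq> 0"
proof -
  obtain B' where B': "B' \<in> tuples E w" "\<nu> B' \<noteq> 0" "set xs \<subseteq> set B'" "set B' \<subseteq> set B \<union> set xs"
    using weak_gp_basis_between[OF gp alt(2) J B xs(2)] by blast
  define cs where "cs = filter (\<lambda>c. c \<notin> set xs) B'"
  have "distinct B'" using alternating_not_distinct[OF alt(1) B'(1)] B'(2) by blast
  then have "distinct (cs @ xs)" "set B' = set (cs @ xs)" using B'(3) xs(1) by (auto simp: cs_def)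
  then have "mset B' = mset (cs @ xs)"
    using \<open>distinct B'\<close> set_eq_iff_mset_eq_distinct by blast
  then have "cs @ xs \<in> tuples E w" "\<nu> (cs @ xs) \<noteq> 0"
    using B' tuples_mset_cong alternating_mset_nonzero[OF alt(1) B'(1)] by blast+
  moreover have "set cs \<subseteq> set B" using B'(4) by (auto simp: cs_def)
  ultimately show thesis using that by blast
qed

lemma weak_gp_complete_by_two:
  fixes \<nu> \<mu> :: "'e list \<Rightarrow> 'a::idom"
  assumes "weak_gp E w \<nu> r \<mu>" "alternating E w \<nu>" "alternating E r \<mu>"
    and "J \<in> tuples E r" "\<mu> J \<noteq> 0" "B \<in> tuples E w" "\<nu> B \<noteq> 0"
    and "distinct xs" "set xs \<subseteq> set J" and len: "Suc (Suc (length xs)) = w"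
  obtains c d where "c \<in> set B" "d \<in> set B" "\<nu> (c # d # xs) \<noteq> 0"
proof -
  obtain cs where cs: "set cs \<subseteq> set B" "cs @ xs \<in> tuples E w" "\<nu> (cs @ xs) \<noteq> 0"
    using weak_gp_complete_to_basis[OF assms(1-9)] .
  then have "length cs = 2" using len by (auto simp: tuples_def)
  then obtain c d where "cs = [c, d]" by (auto simp: length_Suc_conv numeral_2_eq_2)
  then show thesis using cs that[of c d] by simp
qed

section \<open>Weak Pluecker functions are determined near a basis\<close>

text \<open>Completing \<open>xs\<close> to a basis by elements \<open>c\<close>, \<open>d\<close> of \<open>B\<close> exposes a three-term relation in which
  the value at \<open>J\<close> is multiplied by a nonzero value and all other tuples are closer to \<open>B\<close>.\<close>

lemma weak_gp_determined:
  fixes \<phi> \<psi> :: "'e list \<Rightarrow> 'a::idom"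
  assumes alt: "alternating E m \<phi>" "alternating E m \<psi>" and gp: "weak_gp E m \<phi> m \<phi>" "weak_gp E m \<psi> m \<psi>"
    and B: "B \<in> tuples E m" "\<phi> B \<noteq> 0" "\<psi> B \<noteq> 0"
    and near: "\<And>J. J \<in> tuples E m \<Longrightarrow> distinct J \<Longrightarrow> card (set J - set B) \<le> 1 \<Longrightarrow> \<phi> J = \<psi> J"
    and "J \<in> tuples E m"
  shows "\<phi> J = \<psi> J"
  using \<open>J \<in> tuples E m\<close>
proof (induction "card (set J - set B)" arbitrary: J rule: less_induct)
  case less
  show ?case
  proof (rule ccontr)
    assume "\<phi> J \<noteq> \<psi> J"
    then have "distinct J" using alternating_not_distinct alt less.prems by metis
    then have "2 \<le> card (set J - set B)" using near less.prems \<open>\<phi> J \<noteq> \<psi> J\<close> by fastforce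
    then obtain a b xs where ab: "a \<in> set J - set B" "b \<in> set J - set B"
      and J_eq: "mset (a # b # xs) = mset J"
      by (rule mset_eq_two_outside)
    have abxs: "a # b # xs \<in> tuples E m" "distinct (a # b # xs)" "set (a # b # xs) = set J"
      using less.prems \<open>distinct J\<close> tuples_mset_cong[OF J_eq] mset_eq_imp_distinct_iff[OF J_eq]
        mset_eq_setD[OF J_eq] by blast+
    have "set B \<subseteq> E" using B(1) by (simp add: tuples_def)
    have closer: "\<phi> (p # q # xs) = \<psi> (p # q # xs)"
      if "p \<in> {a, b} \<union> set B" "q \<in> {a, b} \<union> set B" "p \<in> set B \<or> q \<in> set B" for p q
    proof (rule less.hyps)
      show "p # q # xs \<in> tuples E m" using abxs(1) that \<open>set B \<subseteq> E\<close> by (auto simp: tuples_def)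
      have "a \<notin> set (p # q # xs) \<or> b \<notin> set (p # q # xs)" using that(3) abxs(2) ab by auto
      moreover have "set (p # q # xs) - set B \<subseteq> set J - set B" using that(1,2) abxs(3) by auto
      ultimately show "card (set (p # q # xs) - set B) < card (set J - set B)"
        using ab by (intro psubset_card_mono) auto
    qed
    have "\<phi> J \<noteq> 0 \<or> \<psi> J \<noteq> 0" using \<open>\<phi> J \<noteq> \<psi> J\<close> by auto
    moreover have "distinct xs" "set xs \<subseteq> set J" "Suc (Suc (length xs)) = m"
      using abxs by (auto simp: tuples_def)
    ultimately obtain c d where cd: "c \<in> set B" "d \<in> set B" "\<phi> (c # d # xs) \<noteq> 0 \<or> \<psi> (c # d # xs) \<noteq> 0"
      using weak_gp_complete_by_two[OF gp(1) alt(1,1) less.prems _ B(1,2)]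
        weak_gp_complete_by_two[OF gp(2) alt(2,2) less.prems _ B(1,3)] by metis
    have "\<phi> (a # b # xs) = \<psi> (a # b # xs)"
    proof (rule weak_gp_three_term_eq[OF gp(1) alt(1) gp(2) alt(2)])
      show "a # c # d # xs \<in> tuples E (Suc m)" "set (b # xs) \<subseteq> E" "Suc (length (b # xs)) = m"
        using abxs(1) cd \<open>set B \<subseteq> E\<close> by (auto simp: tuples_def)
    qed (use cd closer[of c d] in \<open>auto intro!: closer\<close>)
    then show False using alternating_mset_eq[OF alt abxs(1) J_eq] \<open>\<phi> J \<noteq> \<psi> J\<close> by blast
  qed
qed

lemma weak_quotient_determined:
  fixes \<nu> \<mu> \<mu>' :: "'e list \<Rightarrow> 'a::idom"
  assumes alt: "alternating E (Suc r) \<nu>" "alternating E r \<mu>" "alternating E r \<mu>'"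
    and gp: "weak_gp E (Suc r) \<nu> r \<mu>" "weak_gp E (Suc r) \<nu> r \<mu>'"
    and B: "B \<in> tuples E (Suc r)" "\<nu> B \<noteq> 0"
    and inside: "\<And>J. J \<in> tuples E r \<Longrightarrow> distinct J \<Longrightarrow> set J \<subseteq> set B \<Longrightarrow> \<mu> J = \<mu>' J"
    and "J \<in> tuples E r"
  shows "\<mu> J = \<mu>' J"
  using \<open>J \<in> tuples E r\<close>
proof (induction "card (set J - set B)" arbitrary: J rule: less_induct)
  case less
  show ?case
  proof (rule ccontr)
    assume "\<mu> J \<noteq> \<mu>' J"
    then have "distinct J" using alternating_not_distinct alt(2,3) less.prems by metis
    then obtain a where a: "a \<in> set J - set B" using inside less.prems \<open>\<mu> J \<noteq> \<mu>' J\<close> by blast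
    define xs where "xs = remove1 a J"
    have J_eq: "mset (a # xs) = mset J" using a by (simp add: xs_def)
    have axs: "a # xs \<in> tuples E r" "distinct (a # xs)" "set (a # xs) = set J"
      using less.prems \<open>distinct J\<close> tuples_mset_cong[OF J_eq] mset_eq_imp_distinct_iff[OF J_eq]
        mset_eq_setD[OF J_eq] by blast+
    have "set B \<subseteq> E" using B(1) by (simp add: tuples_def)
    have closer: "\<mu> (c # xs) = \<mu>' (c # xs)" if "c \<in> set B" for c
    proof (rule less.hyps)
      show "c # xs \<in> tuples E r" using axs(1) that \<open>set B \<subseteq> E\<close> by (auto simp: tuples_def)
      show "card (set (c # xs) - set B) < card (set J - set B)"
        using a axs(2,3) that by (intro psubset_card_mono) auto
    qed
    have "\<mu> J \<noteq> 0 \<or> \<mu>' J \<noteq> 0" using \<open>\<mu> J \<noteq> \<mu>' J\<close> by auto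
    moreover have "distinct xs" "set xs \<subseteq> set J" "Suc (Suc (length xs)) = Suc r"
      using axs by (auto simp: tuples_def)
    ultimately obtain c d where cd: "c \<in> set B" "d \<in> set B" "\<nu> (c # d # xs) \<noteq> 0"
      using weak_gp_complete_by_two[OF gp(1) alt(1,2) less.prems _ B]
        weak_gp_complete_by_two[OF gp(2) alt(1,3) less.prems _ B] by metis
    have "\<mu> (a # xs) = \<mu>' (a # xs)"
    proof (rule weak_gp_three_term_eq[OF gp(1) alt(2) gp(2) alt(3)])
      show "a # c # d # xs \<in> tuples E (Suc (Suc r))" "set xs \<subseteq> E" "Suc (length xs) = r"
        using axs(1) cd \<open>set B \<subseteq> E\<close> by (auto simp: tuples_def)
    qed (use cd closer in auto)
    then show False using alternating_mset_eq[OF alt(2,3) axs(1) J_eq] \<open>\<mu> J \<noteq> \<mu>' J\<close> by blast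
  qed
qed

section \<open>Determinants\<close>

definition row_det :: "(nat \<Rightarrow> 'a::idom) list \<Rightarrow> 'a" where
  "row_det ws = det (mat (length ws) (length ws) (\<lambda>(i, j). (ws ! i) j))"

lemma row_det_swap:
  assumes "i < length ws" "j < length ws" "i \<noteq> j"
  shows "row_det (ws[i := ws ! j, j := ws ! i]) = - row_det ws"
proof -
  let ?A = "mat (length ws) (length ws) (\<lambda>(i, j). (ws ! i) j)"
  have "det (swaprows i j ?A) = - det ?A" using assms by (intro det_swaprows) auto
  moreover have "swaprows i j ?A =
      mat (length ws) (length ws) (\<lambda>(k, l). (ws[i := ws ! j, j := ws ! i] ! k) l)"
    using assms by (intro eq_matI) (auto simp: nth_list_update)
  ultimately show ?thesis by (simp add: row_det_def)
qed

lemma row_det_not_distinct: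
  assumes "\<not> distinct ws"
  shows "row_det ws = 0"
proof -
  obtain i j where "i < length ws" "j < length ws" "i \<noteq> j" "ws ! i = ws ! j"
    using assms by (auto simp: distinct_conv_nth)
  then show ?thesis
    unfolding row_det_def by (intro det_identical_rows[of _ "length ws" i j]) auto
qed

lemma row_det_to_front: "row_det (us @ v # ws) = (-1) ^ length us * row_det (v # us @ ws)"
proof (induction us arbitrary: ws rule: rev_induct)
  case (snoc u us)
  let ?rows = "us @ v # u # ws" and ?l = "length us"
  have "row_det (?rows[?l := ?rows ! Suc ?l, Suc ?l := ?rows ! ?l]) = - row_det ?rows"
    by (rule row_det_swap) simp_all
  then show ?case using snoc.IH[of "u # ws"] by (simp add: nth_append list_update_append)
qed simp

lemma alternating_row_det_append: "alternating E m (\<lambda>xs. s * row_det (us @ map A xs))"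
  unfolding alternating_def
proof (intro ballI allI impI)
  fix xs i j assume xs: "xs \<in> tuples E m" and ij: "i < j \<and> j < m"
  let ?ws = "us @ map A xs" and ?u = "length us"
  have len: "length xs = m" using xs by (simp add: tuples_def)
  have "us @ map A (xs[i := xs ! j, j := xs ! i]) = ?ws[?u + i := ?ws ! (?u + j), ?u + j := ?ws ! (?u + i)]"
    using ij len by (simp add: list_update_append map_update)
  then have "row_det (us @ map A (xs[i := xs ! j, j := xs ! i])) = - row_det ?ws"
    using ij len row_det_swap[of "?u + i" ?ws "?u + j"] by simp
  moreover have "row_det ?ws = 0" if "xs ! i = xs ! j"
  proof (rule row_det_not_distinct)
    have "\<not> distinct xs" using ij len that nth_eq_iff_index_eq[of xs i j] by auto
    then show "\<not> distinct ?ws" by (simp add: distinct_map)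
  qed
  ultimately show "s * row_det (us @ map A (xs[i := xs ! j, j := xs ! i])) = - (s * row_det ?ws) \<and>
    (xs ! i = xs ! j \<longrightarrow> s * row_det ?ws = 0)" by simp
qed

lemma row_det_Cons_expansion:
  obtains C where "\<And>w. row_det (w # ws) = (\<Sum>i\<le>length ws. w i * C i)"
proof -
  let ?A = "\<lambda>w. mat (Suc (length ws)) (Suc (length ws)) (\<lambda>(i, j). ((w # ws) ! i) j)"
  have "mat_delete (?A w) 0 i = mat_delete (?A w') 0 i" if "i \<le> length ws" for w w' i
    using that by (intro eq_matI) (auto simp: mat_delete_def)
  then have cofactor_eq: "cofactor (?A w) 0 i = cofactor (?A (\<lambda>_. 0)) 0 i" if "i \<le> length ws" for w i
    using that unfolding cofactor_def by metis
  have "row_det (w # ws) = (\<Sum>i\<le>length ws. w i * cofactor (?A (\<lambda>_. 0)) 0 i)" for w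
  proof -
    have "row_det (w # ws) = (\<Sum>i<Suc (length ws). ?A w $$ (0, i) * cofactor (?A w) 0 i)"
      unfolding row_det_def by (subst laplace_expansion_row[of _ "Suc (length ws)" 0]) auto
    also have "\<dots> = (\<Sum>i\<le>length ws. w i * cofactor (?A (\<lambda>_. 0)) 0 i)"
      unfolding lessThan_Suc_atMost by (intro sum.cong arg_cong2[where f = "(*)"] cofactor_eq) auto
    finally show ?thesis .
  qed
  then show thesis by (rule that)
qed

text \<open>Cramer's rule: repeating column \<open>i\<close> of an \<open>m + 1\<close> by \<open>m\<close> matrix gives a singular square matrix,
  which is expanded along the repeated column.\<close>

lemma row_det_linear_dependence:
  assumes len: "length ws = Suc m" and i: "i < m"
  shows "(\<Sum>k\<le>m. (-1) ^ k * row_det (omit k ws) * (ws ! k) i) = 0"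
proof -
  let ?A = "mat (Suc m) (Suc m) (\<lambda>(k, j). (ws ! k) (if j = 0 then i else j - 1))"
  have "det ?A = 0"
    by (rule det_identical_columns[of _ "Suc m" 0 "Suc i"]) (use i in \<open>auto intro!: eq_vecI\<close>)
  moreover have "det ?A = (\<Sum>k<Suc m. ?A $$ (k, 0) * cofactor ?A k 0)"
    by (rule laplace_expansion_column) auto
  moreover have "cofactor ?A k 0 = (-1) ^ k * row_det (omit k ws)" if "k \<le> m" for k
  proof -
    have "mat_delete ?A k 0 = mat m m (\<lambda>(i, j). (omit k ws ! i) j)"
      using that len by (intro eq_matI) (auto simp: mat_delete_def nth_omit insert_index_def)
    then show ?thesis using that len by (simp add: cofactor_def row_det_def min_def)
  qed
  ultimately show ?thesis unfolding lessThan_Suc_atMost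
    by (simp add: mult.commute mult.left_commute)
qed

lemma row_det_pluecker:
  fixes ws vs :: "(nat \<Rightarrow> 'a::idom) list"
  assumes "length ws = Suc (Suc (length vs))"
  shows "sum_mset (gp_terms row_det row_det ws vs) = 0"
proof -
  let ?m = "length vs"
  obtain C where C: "\<And>w. row_det (w # vs) = (\<Sum>i\<le>?m. w i * C i)"
    using row_det_Cons_expansion by blast
  have "sum_mset (gp_terms row_det row_det ws vs) =
      - (\<Sum>k\<le>Suc ?m. \<Sum>i\<le>?m. C i * ((-1) ^ k * row_det (omit k ws) * (ws ! k) i))"
    unfolding sum_gp_terms assms lessThan_Suc_atMost C sum_negf[symmetric]
    by (intro sum.cong) (simp_all add: sum_distrib_left mult_ac sum_negf)
  also have "\<dots> = - (\<Sum>i\<le>?m. C i * (\<Sum>k\<le>Suc ?m. (-1) ^ k * row_det (omit k ws) * (ws ! k) i))"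
    by (subst sum.swap) (simp only: sum_distrib_left)
  also have "\<dots> = 0"
    using row_det_linear_dependence[of ws "Suc ?m"] assms by simp
  finally show ?thesis .
qed

lemma strong_gp_row_det_append:
  assumes len: "length us + w = length vs + r" and sub: "set us \<subseteq> set vs"
  shows "strong_gp E w (\<lambda>xs. s * row_det (us @ map A xs)) r (\<lambda>xs. t * row_det (vs @ map A xs))"
  unfolding gp_relations_def
proof (intro ballI allI impI)
  fix ys xs assume ys: "ys \<in> tuples E (Suc w)" and xs: "set xs \<subseteq> E \<and> Suc (length xs) = r"
  have "0 = sum_mset (gp_terms row_det row_det (us @ map A ys) (vs @ map A xs))"
    using len ys xs by (intro row_det_pluecker[symmetric]) (simp add: tuples_def)
  also have "\<dots> = (-1) ^ length us *
      sum_mset (gp_terms (\<lambda>zs. row_det (us @ zs)) row_det (map A ys) (vs @ map A xs))"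
    using sub by (intro sum_gp_terms_append ballI row_det_not_distinct) auto
  finally have "sum_mset (gp_terms (\<lambda>zs. row_det (us @ zs)) row_det (map A ys) (vs @ map A xs)) = 0"
    unfolding eq_commute[of 0] mult_eq_0_iff by simp
  moreover have "sum_mset (gp_terms (\<lambda>xs. s * row_det (us @ map A xs)) (\<lambda>xs. t * row_det (vs @ map A xs)) ys xs) =
      (-1) ^ length vs * s * t *
        sum_mset (gp_terms (\<lambda>zs. row_det (us @ zs)) row_det (map A ys) (vs @ map A xs))"
    unfolding sum_gp_terms sum_distrib_left length_map
  proof (intro sum.cong refl)
    fix k assume "k \<in> {..<length ys}"
    then have "row_det (map A ys ! k # vs @ map A xs) = (-1) ^ length vs * row_det (vs @ map A (ys ! k # xs))"
      using row_det_to_front[of vs "A (ys ! k)" "map A xs"] by (simp flip: mult.assoc power_add)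
    then show "(-1) ^ Suc k * (s * row_det (us @ map A (omit k ys))) * (t * row_det (vs @ map A (ys ! k # xs))) =
      (-1) ^ length vs * s * t *
        ((-1) ^ Suc k * row_det (us @ omit k (map A ys)) * row_det (map A ys ! k # vs @ map A xs))"
      by (simp add: take_map drop_map mult_ac flip: mult.assoc[of "(-1) ^ length vs" "(-1) ^ length vs"])
  qed
  ultimately show "sum_mset (gp_terms (\<lambda>xs. s * row_det (us @ map A xs)) (\<lambda>xs. t * row_det (vs @ map A xs)) ys xs) = 0"
    by (simp only: mult_zero_right)
qed

lemma row_det_unit_rows:
  assumes len: "length ws = Suc n" and p: "p \<le> n" and i: "i \<le> n"
    and units: "\<And>j l. j < n \<Longrightarrow> l \<le> n \<Longrightarrow> (omit p ws ! j) l = of_bool (l = insert_index i j)"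
  shows "row_det ws = (-1) ^ (p + i) * (ws ! p) i"
proof -
  let ?A = "mat (Suc n) (Suc n) (\<lambda>(k, j). (ws ! k) j)"
  have "(ws ! k) i = 0" if "k \<le> n" "k \<noteq> p" for k
  proof -
    define j where "j = delete_index p k"
    have "j < n" using that p by (auto simp: j_def delete_index_def)
    moreover have "k = insert_index p j" using that by (simp add: j_def insert_delete_index)
    ultimately show ?thesis using units[of j i] i p len by (auto simp: nth_omit insert_index_def split: if_splits)
  qed
  then have "(\<Sum>k<Suc n. ?A $$ (k, i) * cofactor ?A k i) = (\<Sum>k<Suc n. if k = p then (ws ! p) i * cofactor ?A p i else 0)"
    using i by (intro sum.cong) auto
  then have "det ?A = (ws ! p) i * cofactor ?A p i"
    using laplace_expansion_column[of ?A "Suc n" i] i p by auto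
  moreover have "mat_delete ?A p i = 1\<^sub>m n"
  proof (rule eq_matI)
    fix j l assume "j < dim_row (1\<^sub>m n)" "l < dim_col (1\<^sub>m n)"
    then have jl: "j < n" "l < n" by auto
    have "mat_delete ?A p i $$ (j, l) = (omit p ws ! j) (insert_index i l)"
      using jl p len by (subst nth_omit) (auto simp: mat_delete_def insert_index_def)
    also have "\<dots> = of_bool (insert_index i l = insert_index i j)"
      using jl by (intro units) (auto simp: insert_index_def)
    also have "\<dots> = 1\<^sub>m n $$ (j, l)" using jl by (auto simp: insert_index_def split: if_splits)
    finally show "mat_delete ?A p i $$ (j, l) = 1\<^sub>m n $$ (j, l)" .
  qed auto
  ultimately show ?thesis using len by (simp add: row_det_def cofactor_def mult.commute)
qed

section \<open>Determinantal representation\<close>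

definition basis_coord :: "('e list \<Rightarrow> 'a::idom) \<Rightarrow> 'e list \<Rightarrow> 'e \<Rightarrow> nat \<Rightarrow> 'a" where
  "basis_coord \<nu> B x i = \<nu> B * \<nu> (B[i := x])"

text \<open>If \<open>\<nu>\<close> and \<open>\<mu>\<close> are the deletion and the contraction of an additional element, these are the
  coordinates of that element.\<close>

definition quotient_row :: "('e list \<Rightarrow> 'a::idom) \<Rightarrow> ('e list \<Rightarrow> 'a) \<Rightarrow> 'e list \<Rightarrow> nat \<Rightarrow> 'a" where
  "quotient_row \<nu> \<mu> B i = (-1) ^ i * \<nu> B * \<mu> (omit i B)"

lemma basis_coord_nth:
  assumes alt: "alternating E m \<nu>" and B: "B \<in> tuples E m" "\<nu> B * \<nu> B = 1" and ij: "i < m" "j < m"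
  shows "basis_coord \<nu> B (B ! j) i = of_bool (i = j)"
proof (cases "i = j")
  case False
  have len: "length B = m" using B(1) by (simp add: tuples_def)
  have "B[i := B ! j] ! i = B[i := B ! j] ! j" using False ij len by simp
  then have "\<not> distinct (B[i := B ! j])"
    using False ij len by (metis length_list_update nth_eq_iff_index_eq)
  moreover have "B ! j \<in> E" using B(1) ij len nth_mem[of j B] by (auto simp: tuples_def)
  ultimately show ?thesis
    using alternating_not_distinct[OF alt list_update_in_tuples[OF B(1)]] False
    by (simp add: basis_coord_def)
qed (use B(2) in \<open>simp add: basis_coord_def\<close>)

lemma basis_coord_omit:
  assumes alt: "alternating E (Suc n) \<nu>" and B: "B \<in> tuples E (Suc n)" "\<nu> B * \<nu> B = 1"
    and "p \<le> n" "j < n" "l \<le> n"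
  shows "(map (basis_coord \<nu> B) (omit p B) ! j) l = of_bool (l = insert_index p j)"
proof -
  have len: "length B = Suc n" using B(1) by (simp add: tuples_def)
  have "map (basis_coord \<nu> B) (omit p B) ! j = basis_coord \<nu> B (omit p B ! j)"
    using assms(4-) len by (intro nth_map) simp
  also have "omit p B ! j = B ! insert_index p j" using assms(4-) len by (intro nth_omit) simp_all
  finally show ?thesis
    using basis_coord_nth[OF alt B, of l "insert_index p j"] assms(4-) by (simp add: insert_index_def)
qed

lemma row_det_basis_update:
  assumes alt: "alternating E (Suc n) \<nu>" and B: "B \<in> tuples E (Suc n)" "\<nu> B * \<nu> B = 1" and i: "i \<le> n"
  shows "\<nu> B * row_det (map (basis_coord \<nu> B) (B[i := x])) = \<nu> (B[i := x])"
proof -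
  let ?ws = "map (basis_coord \<nu> B) (B[i := x])"
  have len: "length B = Suc n" using B(1) by (simp add: tuples_def)
  have "omit i ?ws = map (basis_coord \<nu> B) (omit i B)" by (simp add: take_map drop_map)
  then have "row_det ?ws = (-1) ^ (i + i) * (?ws ! i) i"
    using i len basis_coord_omit[OF alt B i] by (intro row_det_unit_rows[of _ n]) simp_all
  also have "\<dots> = \<nu> B * \<nu> (B[i := x])" using i len by (simp add: basis_coord_def)
  finally show ?thesis using B(2) by (simp flip: mult.assoc)
qed

lemma row_det_basis_omit:
  assumes alt: "alternating E (Suc n) \<nu>" and B: "B \<in> tuples E (Suc n)" "\<nu> B * \<nu> B = 1" and i: "i \<le> n"
  shows "\<nu> B * row_det (quotient_row \<nu> \<mu> B # map (basis_coord \<nu> B) (omit i B)) = \<mu> (omit i B)"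
proof -
  let ?ws = "quotient_row \<nu> \<mu> B # map (basis_coord \<nu> B) (omit i B)"
  have len: "length B = Suc n" using B(1) by (simp add: tuples_def)
  have "row_det ?ws = (-1) ^ (0 + i) * (?ws ! 0) i"
    using i len basis_coord_omit[OF alt B i] by (intro row_det_unit_rows[of _ n]) simp_all
  also have "\<dots> = \<nu> B * \<mu> (omit i B)"
    by (simp add: quotient_row_def flip: mult.assoc power_add)
  finally show ?thesis using B(2) by (simp flip: mult.assoc)
qed

lemma weak_gp_eq_row_det:
  fixes \<nu> :: "'e list \<Rightarrow> 'a::idom"
  assumes alt: "alternating E (Suc n) \<nu>" and gp: "weak_gp E (Suc n) \<nu> (Suc n) \<nu>"
    and B: "B \<in> tuples E (Suc n)" "\<nu> B * \<nu> B = 1" and J: "J \<in> tuples E (Suc n)"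
  shows "\<nu> J = \<nu> B * row_det (map (basis_coord \<nu> B) J)"
proof -
  define \<nu>' where "\<nu>' = (\<lambda>xs. \<nu> B * row_det (map (basis_coord \<nu> B) xs))"
  have alt': "alternating E (Suc n) \<nu>'"
    unfolding \<nu>'_def using alternating_row_det_append[where us = "[]"] by simp
  have gp': "weak_gp E (Suc n) \<nu>' (Suc n) \<nu>'"
    unfolding \<nu>'_def using strong_gp_row_det_append[of "[]" "Suc n" "[]" "Suc n" E "\<nu> B" "basis_coord \<nu> B" "\<nu> B"]
    by (intro strong_gp_imp_weak_gp) simp
  have nonzero: "\<nu> B \<noteq> 0" "\<nu>' B \<noteq> 0"
    using B(2) row_det_basis_update[OF alt B, of 0 "B ! 0"] by (auto simp: \<nu>'_def)
  have len: "length B = Suc n" using B(1) by (simp add: tuples_def)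
  have "distinct B" using alternating_not_distinct[OF alt B(1)] nonzero by blast
  have "\<nu> xs = \<nu>' xs"
    if xs: "xs \<in> tuples E (Suc n)" "distinct xs" "card (set xs - set B) \<le> 1" for xs
  proof -
    have "length xs = length B" "xs \<noteq> []" using xs(1) len by (auto simp: tuples_def)
    then obtain i x where ix: "i < length B" "x \<in> set xs" "mset (B[i := x]) = mset xs"
      using mset_eq_list_update[OF xs(2) \<open>distinct B\<close> _ _ xs(3)] by blast
    then have "\<nu> (B[i := x]) = \<nu>' (B[i := x])"
      unfolding \<nu>'_def using row_det_basis_update[OF alt B] len by simp
    moreover have "B[i := x] \<in> tuples E (Suc n)" using tuples_mset_cong[OF ix(3)] xs(1) by simp
    ultimately show ?thesis using alternating_mset_eq[OF alt alt' _ ix(3)] by blast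
  qed
  then have "\<nu> J = \<nu>' J" by (rule weak_gp_determined[OF alt alt' gp gp' B(1) nonzero _ J])
  then show ?thesis by (simp add: \<nu>'_def)
qed

lemma weak_quotient_eq_row_det:
  fixes \<nu> \<mu> :: "'e list \<Rightarrow> 'a::idom"
  assumes alt: "alternating E (Suc r) \<nu>" "alternating E r \<mu>"
    and gp: "weak_gp E (Suc r) \<nu> (Suc r) \<nu>" "weak_gp E (Suc r) \<nu> r \<mu>"
    and B: "B \<in> tuples E (Suc r)" "\<nu> B * \<nu> B = 1" and J: "J \<in> tuples E r"
  shows "\<mu> J = \<nu> B * row_det (quotient_row \<nu> \<mu> B # map (basis_coord \<nu> B) J)"
proof -
  define \<mu>' where "\<mu>' = (\<lambda>xs. \<nu> B * row_det (quotient_row \<nu> \<mu> B # map (basis_coord \<nu> B) xs))"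
  have alt': "alternating E r \<mu>'"
    unfolding \<mu>'_def using alternating_row_det_append[where us = "[quotient_row \<nu> \<mu> B]"] by simp
  have "strong_gp E (Suc r) (\<lambda>xs. \<nu> B * row_det (map (basis_coord \<nu> B) xs)) r \<mu>'"
    unfolding \<mu>'_def
    using strong_gp_row_det_append[of "[]" "Suc r" "[quotient_row \<nu> \<mu> B]" r E "\<nu> B" "basis_coord \<nu> B" "\<nu> B"]
    by simp
  then have gp': "weak_gp E (Suc r) \<nu> r \<mu>'"
    using weak_gp_eq_row_det[OF alt(1) gp(1) B]
    by (intro strong_gp_imp_weak_gp gp_relations_cong[of _ E "Suc r" _ r \<mu>' \<nu> \<mu>']) auto
  have "\<nu> B \<noteq> 0" using B(2) by auto
  then have "distinct B" using alternating_not_distinct[OF alt(1) B(1)] by blast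
  have len: "length B = Suc r" using B(1) by (simp add: tuples_def)
  have "\<mu> xs = \<mu>' xs" if xs: "xs \<in> tuples E r" "distinct xs" "set xs \<subseteq> set B" for xs
  proof -
    obtain i where i: "i < length B" "mset (omit i B) = mset xs"
      using mset_eq_omit[OF xs(2) \<open>distinct B\<close> xs(3)] xs(1) len by (auto simp: tuples_def)
    then have "\<mu> (omit i B) = \<mu>' (omit i B)"
      unfolding \<mu>'_def using row_det_basis_omit[OF alt(1) B] len by simp
    moreover have "omit i B \<in> tuples E r" using tuples_mset_cong[OF i(2)] xs(1) by simp
    ultimately show ?thesis using alternating_mset_eq[OF alt(2) alt' _ i(2)] by blast
  qed
  then have "\<mu> J = \<mu>' J"
    by (rule weak_quotient_determined[OF alt alt' gp(2) gp' B(1) \<open>\<nu> B \<noteq> 0\<close> _ J])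
  then show ?thesis by (simp add: \<mu>'_def)
qed

theorem weak_gp_imp_strong_gp:
  fixes \<nu> \<mu> :: "'e list \<Rightarrow> 'a::idom"
  assumes "alternating E (Suc r) \<nu>" "alternating E r \<mu>"
    and "weak_gp E (Suc r) \<nu> (Suc r) \<nu>" "weak_gp E (Suc r) \<nu> r \<mu>"
    and "B \<in> tuples E (Suc r)" "\<nu> B * \<nu> B = 1"
  shows "strong_gp E (Suc r) \<nu> (Suc r) \<nu>" "strong_gp E (Suc r) \<nu> r \<mu>" "strong_gp E r \<mu> r \<mu>"
proof -
  define v where "v = quotient_row \<nu> \<mu> B"
  define A where "A = basis_coord \<nu> B"
  have \<nu>: "\<nu> B * row_det ([] @ map A xs) = \<nu> xs" if "xs \<in> tuples E (Suc r)" for xs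
    using weak_gp_eq_row_det[OF assms(1,3,5,6) that] by (simp add: A_def)
  have \<mu>: "\<nu> B * row_det ([v] @ map A xs) = \<mu> xs" if "xs \<in> tuples E r" for xs
    using weak_quotient_eq_row_det[OF assms that] by (simp add: A_def v_def)
  show "strong_gp E (Suc r) \<nu> (Suc r) \<nu>"
    by (rule gp_relations_cong[OF strong_gp_row_det_append \<nu> \<nu>]) simp_all
  show "strong_gp E (Suc r) \<nu> r \<mu>"
    by (rule gp_relations_cong[OF strong_gp_row_det_append \<nu> \<mu>]) simp_all
  show "strong_gp E r \<mu> r \<mu>"
    by (rule gp_relations_cong[OF strong_gp_row_det_append \<mu> \<mu>]) simp_all
qed

section \<open>Rescaling and push-forward of Pluecker relations\<close>

lemma gp_functions_carrier: "\<phi> \<in> gp_functions F E r \<Longrightarrow> xs \<in> tuples E r \<Longrightarrow> \<phi> xs \<in> carrier F"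
  by (auto simp: gp_functions_def)

context tract
begin

lemma eps_Units: "eps F \<in> Units F" and eps_nullset: "{#\<one>, eps F#} \<in> nullset F"
  using theI'[OF unique_eps] unfolding eps_def by blast+

lemma Units_mult_eq_zero_iff:
  assumes "a \<in> Units F" "b \<in> carrier F"
  shows "a \<otimes> b = tzero F \<longleftrightarrow> b = tzero F"
proof
  assume "a \<otimes> b = tzero F"
  then show "b = tzero F" using assms Units_m_closed[of a b] Units_eq by auto
next
  assume "b = tzero F"
  then show "a \<otimes> b = tzero F"
    using assms zero_absorbing[of a] zero_closed m_comm[of a b] by (simp add: Units_closed)
qed

lemma null_sum_image:
  assumes "set_mset S \<subseteq> carrier F" "null_sum F S"
    and zero: "\<And>a. a \<in> carrier F \<Longrightarrow> h a = tzero F' \<longleftrightarrow> a = tzero F"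
    and null: "\<And>S. S \<in> nullset F \<Longrightarrow> image_mset h S \<in> nullset F'"
  shows "null_sum F' (image_mset h S)"
proof -
  have "{# b \<in># image_mset h S. b \<noteq> tzero F' #} = image_mset h {# a \<in># S. a \<noteq> tzero F #}"
    unfolding filter_mset_image_mset using assms(1) zero
    by (intro arg_cong[where f = "image_mset _"] filter_mset_cong) auto
  then show ?thesis using assms(2) null by (simp add: null_sum_def)
qed

lemma pluecker_relations_image:
  assumes gp: "pluecker_relations F E w \<nu> r \<mu>"
    and \<nu>: "\<And>xs. xs \<in> tuples E w \<Longrightarrow> \<nu> xs \<in> carrier F"
    and \<mu>: "\<And>xs. xs \<in> tuples E r \<Longrightarrow> \<mu> xs \<in> carrier F"
    and zero: "\<And>a. a \<in> carrier F \<Longrightarrow> h a = tzero F' \<longleftrightarrow> a = tzero F"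
    and null: "\<And>S. S \<in> nullset F \<Longrightarrow> image_mset h S \<in> nullset F'"
    and mult: "\<And>n a b. a \<in> carrier F \<Longrightarrow> b \<in> carrier F \<Longrightarrow>
      h (eps F [^] (n::nat) \<otimes> a \<otimes> b) = eps F' [^]\<^bsub>F'\<^esub> n \<otimes>\<^bsub>F'\<^esub> f a \<otimes>\<^bsub>F'\<^esub> g b"
  shows "pluecker_relations F' E w (\<lambda>xs\<in>tuples E w. f (\<nu> xs)) r (\<lambda>xs\<in>tuples E r. g (\<mu> xs))"
  unfolding pluecker_relations_def
proof (intro ballI allI impI)
  fix ys xs assume ys: "ys \<in> tuples E (Suc w)" and xs: "set xs \<subseteq> E \<and> Suc (length xs) = r"
  let ?t = "\<lambda>k. eps F [^] Suc k \<otimes> \<nu> (omit k ys) \<otimes> \<mu> (ys ! k # xs)"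
  let ?t' = "\<lambda>k. eps F' [^]\<^bsub>F'\<^esub> Suc k \<otimes>\<^bsub>F'\<^esub> (\<lambda>xs\<in>tuples E w. f (\<nu> xs)) (omit k ys) \<otimes>\<^bsub>F'\<^esub>
    (\<lambda>xs\<in>tuples E r. g (\<mu> xs)) (ys ! k # xs)"
  have args: "omit k ys \<in> tuples E w" "ys ! k # xs \<in> tuples E r" if "k \<le> w" for k
    using that ys xs omit_in_tuples nth_Cons_in_tuples[of ys E "Suc w" k xs r] by auto
  have "null_sum F {# ?t k. k \<in># mset_set {0..w} #}"
    using gp ys xs unfolding pluecker_relations_def by blast
  moreover have "?t k \<in> carrier F" if "k \<le> w" for k
    using \<nu>[OF args(1)[OF that]] \<mu>[OF args(2)[OF that]] eps_Units by (auto simp: Units_closed)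
  ultimately have "null_sum F' (image_mset h {# ?t k. k \<in># mset_set {0..w} #})"
    by (intro null_sum_image zero null) auto
  also have "image_mset h {# ?t k. k \<in># mset_set {0..w} #} = {# ?t' k. k \<in># mset_set {0..w} #}"
    unfolding multiset.map_comp o_def
  proof (intro image_mset_cong)
    fix k assume "k \<in># mset_set {0..w}"
    then have "k \<le> w" by simp
    then show "h (?t k) = ?t' k" using mult[OF \<nu>[OF args(1)] \<mu>[OF args(2)]] args by (simp only: restrict_apply')
  qed
  finally show "null_sum F' {# ?t' k. k \<in># mset_set {0..w} #}" .
qed

lemma pluecker_relations_scale:
  assumes gp: "pluecker_relations F E w \<nu> r \<mu>"
    and \<nu>: "\<And>xs. xs \<in> tuples E w \<Longrightarrow> \<nu> xs \<in> carrier F"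
    and \<mu>: "\<And>xs. xs \<in> tuples E r \<Longrightarrow> \<mu> xs \<in> carrier F"
    and ab: "a \<in> Units F" "b \<in> Units F"
  shows "pluecker_relations F E w (\<lambda>xs\<in>tuples E w. a \<otimes> \<nu> xs) r (\<lambda>xs\<in>tuples E r. b \<otimes> \<mu> xs)"
proof (rule pluecker_relations_image[OF gp \<nu> \<mu>, where h = "\<lambda>c. (a \<otimes> b) \<otimes> c"])
  fix n :: nat and c d assume "c \<in> carrier F" "d \<in> carrier F"
  moreover have "eps F [^] n \<in> carrier F" using eps_Units by (simp add: Units_closed)
  ultimately show "(a \<otimes> b) \<otimes> (eps F [^] n \<otimes> c \<otimes> d) = eps F [^] n \<otimes> (a \<otimes> c) \<otimes> (b \<otimes> d)"
    using ab by (simp only: Units_closed m_assoc m_lcomm m_closed)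
qed (use ab in \<open>simp_all add: Units_mult_eq_zero_iff nullset_stable\<close>)

end

locale tract_morphism = F: tract F + F': tract F'
  for F :: "('a, 'c) tract_data_scheme" and F' :: "('b, 'd) tract_data_scheme" +
  fixes f :: "'a \<Rightarrow> 'b"
  assumes hom: "f \<in> tract_hom F F'"
begin

lemma closed: "a \<in> carrier F \<Longrightarrow> f a \<in> carrier F'"
  and mult: "a \<in> carrier F \<Longrightarrow> b \<in> carrier F \<Longrightarrow> f (a \<otimes>\<^bsub>F\<^esub> b) = f a \<otimes>\<^bsub>F'\<^esub> f b"
  and zero: "f (tzero F) = tzero F'"
  and one: "f \<one>\<^bsub>F\<^esub> = \<one>\<^bsub>F'\<^esub>"
  and nullset: "S \<in> nullset F \<Longrightarrow> image_mset f S \<in> nullset F'"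
  using hom by (auto simp: tract_hom_def hom_def)

lemma Units: "a \<in> Units F \<Longrightarrow> f a \<in> Units F'"
  using mult[of a "inv\<^bsub>F\<^esub> a"] mult[of "inv\<^bsub>F\<^esub> a" a] one closed
  unfolding Units_def[of F'] by (force simp: F.Units_closed)

lemma eq_zero_iff: "a \<in> carrier F \<Longrightarrow> f a = tzero F' \<longleftrightarrow> a = tzero F"
  using Units[of a] zero F.Units_eq F'.Units_eq by auto

lemma eps: "f (eps F) = eps F'"
  using nullset[OF F.eps_nullset] one Units[OF F.eps_Units] F'.tract_epsI by simp

lemma nat_pow: "a \<in> carrier F \<Longrightarrow> f (a [^]\<^bsub>F\<^esub> (n::nat)) = f a [^]\<^bsub>F'\<^esub> n"
  by (induction n) (simp_all add: one mult)

lemma pluecker_relations_push_forward: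
  assumes gp: "pluecker_relations F E w \<nu> r \<mu>"
    and \<nu>: "\<And>xs. xs \<in> tuples E w \<Longrightarrow> \<nu> xs \<in> carrier F"
    and \<mu>: "\<And>xs. xs \<in> tuples E r \<Longrightarrow> \<mu> xs \<in> carrier F"
  shows "pluecker_relations F' E w (\<lambda>xs\<in>tuples E w. f (\<nu> xs)) r (\<lambda>xs\<in>tuples E r. f (\<mu> xs))"
  using F.eps_Units
  by (intro F.pluecker_relations_image[OF gp \<nu> \<mu>, where h = f] eq_zero_iff nullset)
    (simp_all add: mult nat_pow eps F.Units_closed)

lemma gp_functions_push_forward:
  assumes \<phi>: "\<phi> \<in> gp_functions F E r"
  shows "(\<lambda>xs\<in>tuples E r. f (\<phi> xs)) \<in> gp_functions F' E r"
proof -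
  note carrier = gp_functions_carrier[OF \<phi>]
  have gp: "pluecker_relations F E r \<phi> r \<phi>" and nonzero: "\<exists>xs\<in>tuples E r. \<phi> xs \<noteq> tzero F"
    and alt: "\<And>xs i j. xs \<in> tuples E r \<Longrightarrow> i < j \<Longrightarrow> j < r \<Longrightarrow>
        \<phi> (xs[i := xs ! j, j := xs ! i]) = eps F \<otimes>\<^bsub>F\<^esub> \<phi> xs \<and> (xs ! i = xs ! j \<longrightarrow> \<phi> xs = tzero F)"
    using \<phi> unfolding gp_functions_def by blast+
  show ?thesis
    unfolding gp_functions_def
  proof (intro CollectI conjI ballI allI impI)
    show "pluecker_relations F' E r (\<lambda>xs\<in>tuples E r. f (\<phi> xs)) r (\<lambda>xs\<in>tuples E r. f (\<phi> xs))"
      by (rule pluecker_relations_push_forward[OF gp carrier carrier])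
    show "\<exists>xs\<in>tuples E r. (\<lambda>xs\<in>tuples E r. f (\<phi> xs)) xs \<noteq> tzero F'"
      using nonzero eq_zero_iff carrier by (metis restrict_apply')
  next
    fix xs i j assume xs: "xs \<in> tuples E r" and ij: "i < j \<and> j < r"
    then have "xs[i := xs ! j, j := xs ! i] \<in> tuples E r"
      using tuples_mset_cong[OF mset_swap[of j xs i]] by (simp add: tuples_def)
    then show "(\<lambda>xs\<in>tuples E r. f (\<phi> xs)) (xs[i := xs ! j, j := xs ! i]) =
        eps F' \<otimes>\<^bsub>F'\<^esub> (\<lambda>xs\<in>tuples E r. f (\<phi> xs)) xs"
      using xs ij alt[of xs i j] mult[of "eps F" "\<phi> xs"] carrier F.eps_Units eps
      by (simp add: F.Units_closed)
    show "(\<lambda>xs\<in>tuples E r. f (\<phi> xs)) xs = tzero F'" if "xs ! i = xs ! j"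
      using xs ij that alt[of xs i j] zero by simp
  qed (use carrier closed in auto)
qed

end

section \<open>Flags of two matroids\<close>

definition gp_support :: "('a, 'b) tract_data_scheme \<Rightarrow> 'e set \<Rightarrow> nat \<Rightarrow> ('e list \<Rightarrow> 'a) \<Rightarrow> 'e list \<Rightarrow> nat" where
  "gp_support F E r \<phi> = (\<lambda>xs\<in>tuples E r. to_krasner F (\<phi> xs))"

definition gp_matroid ::
    "('a, 'b) tract_data_scheme \<Rightarrow> 'e set \<Rightarrow> nat \<Rightarrow> ('e list \<Rightarrow> 'a) \<Rightarrow> ('e, 'a) coeff_matroid" where
  "gp_matroid F E r \<phi> = \<lparr>mrank = r, mclass = gp_class F E r \<phi>\<rparr>"

definition gp_flag ::
    "('a, 'b) tract_data_scheme \<Rightarrow> 'e set \<Rightarrow> nat \<Rightarrow> ('e list \<Rightarrow> 'a) \<Rightarrow> nat \<Rightarrow> ('e list \<Rightarrow> 'a) \<Rightarrow> bool" where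
  "gp_flag F E r \<mu> w \<nu> \<longleftrightarrow>
     \<mu> \<in> gp_functions F E r \<and> \<nu> \<in> gp_functions F E w \<and> pluecker_relations F E w \<nu> r \<mu>"

definition representable_flag ::
    "('a, 'b) tract_data_scheme \<Rightarrow> 'e set \<Rightarrow> ('e, nat) coeff_matroid list \<Rightarrow> bool" where
  "representable_flag F E M \<longleftrightarrow>
     (\<exists>N. flag_matroid F E N \<and> M = flag_push_forward krasner E (to_krasner F) N)"

definition support_matroid ::
    "('a, 'b) tract_data_scheme \<Rightarrow> 'e set \<Rightarrow> nat \<Rightarrow> ('e list \<Rightarrow> 'a) \<Rightarrow> ('e, nat) coeff_matroid" where
  "support_matroid F E r \<phi> = \<lparr>mrank = r, mclass = {gp_support F E r \<phi>}\<rparr>"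

lemma mrank_gp_matroid [simp]: "mrank (gp_matroid F E r \<phi>) = r"
  by (simp add: gp_matroid_def)

lemma coeff_matroids_eq_gp_matroids:
  "coeff_matroids F E = {gp_matroid F E r \<phi> | r \<phi>. \<phi> \<in> gp_functions F E r}"
  by (simp add: coeff_matroids_def gp_matroid_def)

lemma gp_class_krasner: "gp_class krasner E r \<psi> = {\<lambda>xs\<in>tuples E r. \<psi> xs}"
  unfolding gp_class_def Units_krasner by (simp add: krasner_def)

context tract
begin

lemma gp_class_self:
  assumes "\<phi> \<in> gp_functions F E r"
  shows "\<phi> \<in> gp_class F E r \<phi>"
proof -
  have "\<phi> = (\<lambda>xs\<in>tuples E r. \<one> \<otimes> \<phi> xs)"
    using assms gp_functions_carrier[OF assms]
    by (auto simp: gp_functions_def PiE_iff extensional_def restrict_def)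
  then show ?thesis unfolding gp_class_def using Units_one_closed by blast
qed

lemma matroid_quotient_gp_matroid:
  assumes "\<nu> \<in> gp_functions F E w" "\<mu> \<in> gp_functions F E r"
  shows "matroid_quotient F E (gp_matroid F E w \<nu>) (gp_matroid F E r \<mu>) \<longleftrightarrow> pluecker_relations F E w \<nu> r \<mu>"
proof
  assume "pluecker_relations F E w \<nu> r \<mu>"
  from pluecker_relations_scale[OF this gp_functions_carrier[OF assms(1)] gp_functions_carrier[OF assms(2)]]
  show "matroid_quotient F E (gp_matroid F E w \<nu>) (gp_matroid F E r \<mu>)"
    unfolding matroid_quotient_def gp_matroid_def gp_class_def by auto
qed (use assms[THEN gp_class_self] in \<open>auto simp: matroid_quotient_def gp_matroid_def\<close>)

lemma push_forward_gp_matroid: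
  assumes "\<phi> \<in> gp_functions F E r"
  shows "push_forward krasner E (to_krasner F) (gp_matroid F E r \<phi>) = support_matroid F E r \<phi>"
  using push_forward_class[OF tract_krasner to_krasner_hom assms]
  by (simp add: gp_matroid_def support_matroid_def gp_class_krasner gp_support_def)

lemma flag_matroid_pair_iff:
  "flag_matroid F E [M\<^sub>1, M\<^sub>2] \<longleftrightarrow>
    M\<^sub>1 \<in> coeff_matroids F E \<and> M\<^sub>2 \<in> coeff_matroids F E \<and> matroid_quotient F E M\<^sub>2 M\<^sub>1"
proof -
  have "i < j \<and> j < length [M\<^sub>1, M\<^sub>2] \<longleftrightarrow> i = 0 \<and> j = 1" for i j by auto
  then show ?thesis unfolding flag_matroid_def by simp
qed

lemma flag_matroid_rank_pair_iff:
  "flag_matroid F E N \<and> flag_rank N = [r, w] \<longleftrightarrow>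
    (\<exists>\<mu> \<nu>. gp_flag F E r \<mu> w \<nu> \<and> N = [gp_matroid F E r \<mu>, gp_matroid F E w \<nu>])"
proof
  assume N: "flag_matroid F E N \<and> flag_rank N = [r, w]"
  then obtain M\<^sub>1 M\<^sub>2 where N_eq: "N = [M\<^sub>1, M\<^sub>2]" and rank: "mrank M\<^sub>1 = r" "mrank M\<^sub>2 = w"
    by (auto simp: flag_rank_def)
  then obtain \<mu> \<nu> where "\<mu> \<in> gp_functions F E r" "M\<^sub>1 = gp_matroid F E r \<mu>"
    "\<nu> \<in> gp_functions F E w" "M\<^sub>2 = gp_matroid F E w \<nu>"
    using N unfolding N_eq flag_matroid_pair_iff by (auto simp: coeff_matroids_eq_gp_matroids)
  then show "\<exists>\<mu> \<nu>. gp_flag F E r \<mu> w \<nu> \<and> N = [gp_matroid F E r \<mu>, gp_matroid F E w \<nu>]"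
    using N unfolding N_eq flag_matroid_pair_iff gp_flag_def by (auto simp: matroid_quotient_gp_matroid)
next
  assume "\<exists>\<mu> \<nu>. gp_flag F E r \<mu> w \<nu> \<and> N = [gp_matroid F E r \<mu>, gp_matroid F E w \<nu>]"
  then show "flag_matroid F E N \<and> flag_rank N = [r, w]"
    unfolding gp_flag_def
    by (auto simp: flag_matroid_pair_iff matroid_quotient_gp_matroid flag_rank_def coeff_matroids_eq_gp_matroids)
      blast+
qed

lemma representable_flag_iff:
  assumes "flag_rank M = [r, w]"
  shows "representable_flag F E M \<longleftrightarrow>
    (\<exists>\<mu> \<nu>. gp_flag F E r \<mu> w \<nu> \<and> M = [support_matroid F E r \<mu>, support_matroid F E w \<nu>])"
proof -
  have "flag_rank N = [r, w]" if "M = flag_push_forward krasner E (to_krasner F) N" for N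
    using assms that by (simp add: flag_rank_def flag_push_forward_def push_forward_def comp_def)
  then have "representable_flag F E M \<longleftrightarrow> (\<exists>N. (flag_matroid F E N \<and> flag_rank N = [r, w]) \<and>
      M = flag_push_forward krasner E (to_krasner F) N)"
    unfolding representable_flag_def by blast
  also have "\<dots> \<longleftrightarrow> (\<exists>\<mu> \<nu>. gp_flag F E r \<mu> w \<nu> \<and>
      M = flag_push_forward krasner E (to_krasner F) [gp_matroid F E r \<mu>, gp_matroid F E w \<nu>])"
    unfolding flag_matroid_rank_pair_iff by blast
  also have "\<dots> \<longleftrightarrow> (\<exists>\<mu> \<nu>. gp_flag F E r \<mu> w \<nu> \<and> M = [support_matroid F E r \<mu>, support_matroid F E w \<nu>])"
    by (simp add: gp_flag_def flag_push_forward_def push_forward_gp_matroid cong: conj_cong)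
  finally show ?thesis .
qed

end

context tract_morphism
begin

lemma gp_flag_push_forward:
  assumes "gp_flag F E r \<mu> w \<nu>"
  shows "gp_flag F' E r (\<lambda>xs\<in>tuples E r. f (\<mu> xs)) w (\<lambda>xs\<in>tuples E w. f (\<nu> xs))"
  using assms unfolding gp_flag_def
  by (auto intro!: gp_functions_push_forward pluecker_relations_push_forward gp_functions_carrier)

lemma support_matroid_push_forward:
  assumes "\<phi> \<in> gp_functions F E r"
  shows "support_matroid F' E r (\<lambda>xs\<in>tuples E r. f (\<phi> xs)) = support_matroid F E r \<phi>"
  using gp_functions_carrier[OF assms] eq_zero_iff
  by (auto simp: support_matroid_def gp_support_def to_krasner_def intro!: restrict_ext)

lemma representable_flag_push_forward:
  assumes "flag_rank M = [r, w]" "representable_flag F E M"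
  shows "representable_flag F' E M"
proof -
  obtain \<mu> \<nu> where gp: "gp_flag F E r \<mu> w \<nu>" and "M = [support_matroid F E r \<mu>, support_matroid F E w \<nu>]"
    using assms unfolding F.representable_flag_iff[OF assms(1)] by blast
  then have "M = [support_matroid F' E r (\<lambda>xs\<in>tuples E r. f (\<mu> xs)),
      support_matroid F' E w (\<lambda>xs\<in>tuples E w. f (\<nu> xs))]"
    by (simp add: gp_flag_def support_matroid_push_forward)
  then show ?thesis
    unfolding F'.representable_flag_iff[OF assms(1)] using gp_flag_push_forward[OF gp] by blast
qed

end

lemma tract_morphism_F1pm_F2: "tract_morphism F1pm F2 of_int"
proof -
  have "image_mset of_int S \<in> nullset F2" if "S \<in> nullset F1pm" for S
    using that by (auto simp: F1pm_def F2_def split: if_splits)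
  then have "of_int \<in> tract_hom F1pm F2"
    by (auto simp: tract_hom_def hom_def F1pm_def F2_def)
  then show ?thesis
    using tract_F1pm tract_F2 by (simp add: tract_morphism_def tract_morphism_axioms_def)
qed

lemma tract_morphism_F1pm_sign_hyperfield: "tract_morphism F1pm sign_hyperfield id"
proof -
  have "S \<in> nullset sign_hyperfield" if "S \<in> nullset F1pm" for S
    using that unfolding F1pm_nullset_iff sign_hyperfield_nullset_iff
    by (metis count_greater_zero_iff)
  then have "id \<in> tract_hom F1pm sign_hyperfield"
    by (auto simp: tract_hom_def hom_def) (auto simp: F1pm_def sign_hyperfield_def)
  then show ?thesis
    using tract_F1pm tract_sign_hyperfield by (simp add: tract_morphism_def tract_morphism_axioms_def)
qed

section \<open>Signs\<close>

lemma sum_mset_filter_nonzero: "sum_mset {# t \<in># S. t \<noteq> 0 #} = sum_mset S"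
  by (induction S) auto

lemma signed_multiset:
  fixes S :: "int multiset"
  assumes "set_mset S \<subseteq> {0, 1, -1}"
  shows filter_nonzero_signed_mset:
      "{# t \<in># S. t \<noteq> 0 #} = replicate_mset (count S 1) 1 + replicate_mset (count S (-1)) (-1)"
    and sum_signed_mset: "sum_mset S = int (count S 1) - int (count S (-1))"
proof -
  show filter: "{# t \<in># S. t \<noteq> 0 #} = replicate_mset (count S 1) 1 + replicate_mset (count S (-1)) (-1)"
    using assms by (intro multiset_eqI) (auto simp: not_in_iff[symmetric])
  show "sum_mset S = int (count S 1) - int (count S (-1))"
    using sum_mset_filter_nonzero[of S] unfolding filter by simp
qed

lemma null_sum_F1pm_iff:
  assumes "set_mset S \<subseteq> {0, 1, -1}"
  shows "null_sum F1pm S \<longleftrightarrow> sum_mset S = 0"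
proof -
  have "tzero F1pm = 0" by (simp add: F1pm_def)
  then show ?thesis
    unfolding null_sum_def F1pm_nullset_iff using signed_multiset[OF assms] by auto
qed

lemma null_sum_sign_hyperfield_iff:
  assumes "set_mset S \<subseteq> {0, 1, -1}"
  shows "null_sum sign_hyperfield S \<longleftrightarrow> (1 \<in># S \<longleftrightarrow> -1 \<in># S)"
  using assms unfolding null_sum_def sign_hyperfield_nullset_iff by (auto simp: sign_hyperfield_def)

lemma null_sum_F2_iff: "null_sum F2 S \<longleftrightarrow> sum_mset S = 0"
proof -
  have F2_simps: "tzero F2 = 0" "nullset F2 = {S. 0 \<notin># S \<and> sum_mset S = 0}" by (simp_all add: F2_def)
  show ?thesis
    unfolding null_sum_def F2_simps mem_Collect_eq sum_mset_filter_nonzero by simp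
qed

lemma of_int_sum_mset: "of_int (sum_mset S) = sum_mset (image_mset of_int S)"
  by (induction S) simp_all

lemma of_int_bit_eq_0_iff: "of_int a = (0::bit) \<longleftrightarrow> even a"
proof (cases "even a")
  case False
  then obtain b where "a = 2 * b + 1" by (rule oddE)
  then show ?thesis by simp
qed (auto elim!: evenE)

text \<open>At most three nonzero signs, both of which occur and whose number is even: one of each.\<close>

lemma weakly_null_signs:
  assumes "set_mset S \<subseteq> {0, 1, -1}" "null_sum sign_hyperfield S" "null_sum F2 (image_mset of_int S)"
  shows "weakly_null S"
proof -
  define p q where counts: "p = count S 1" "q = count S (-1)"
  have "p = 0 \<longleftrightarrow> q = 0"
    using assms(2) unfolding null_sum_sign_hyperfield_iff[OF assms(1)] counts by (simp add: count_eq_zero_iff)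
  moreover have "even (sum_mset S)"
    using assms(3) unfolding null_sum_F2_iff of_int_sum_mset[symmetric] of_int_bit_eq_0_iff .
  then have "even (int p - int q)" using sum_signed_mset[OF assms(1)] by (simp add: counts)
  ultimately have "p + q \<le> 3 \<longrightarrow> p = q" by presburger
  then show ?thesis unfolding weakly_null_def signed_multiset[OF assms(1)] by (simp add: counts[symmetric])
qed

section \<open>Binary and orientable implies regular\<close>

lemma pluecker_relations_eq_gp_relations:
  fixes F :: "('a::comm_ring_1, 'b) tract_data_scheme"
  assumes F: "monoid.mult F = (*)" "one F = 1" "eps F = -1"
  shows "pluecker_relations F = gp_relations (null_sum F)"
proof (intro ext)
  fix E w r and \<nu> \<mu> :: "'e list \<Rightarrow> 'a"
  have pow: "x [^]\<^bsub>F\<^esub> n = x ^ n" for x and n :: nat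
    by (induction n) (simp_all add: nat_pow_def F)
  have "{# eps F [^]\<^bsub>F\<^esub> Suc k \<otimes>\<^bsub>F\<^esub> \<nu> (omit k ys) \<otimes>\<^bsub>F\<^esub> \<mu> (ys ! k # xs). k \<in># mset_set {0..w} #} =
      gp_terms \<nu> \<mu> ys xs" if "ys \<in> tuples E (Suc w)" for ys xs
  proof -
    have "length ys = Suc w" using that by (simp add: tuples_def)
    then show ?thesis
      by (simp only: gp_terms_def mset_map mset_upt atLeastLessThanSuc_atLeastAtMost pow F)
  qed
  then show "pluecker_relations F E w \<nu> r \<mu> = gp_relations (null_sum F) E w \<nu> r \<mu>"
    unfolding pluecker_relations_def gp_relations_def by simp
qed

lemma pluecker_relations_F1pm: "pluecker_relations F1pm = gp_relations (null_sum F1pm)"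
  by (rule pluecker_relations_eq_gp_relations[OF _ _ eps_F1pm]) (simp_all add: F1pm_def)

lemma pluecker_relations_sign_hyperfield:
  "pluecker_relations sign_hyperfield = gp_relations (null_sum sign_hyperfield)"
  by (rule pluecker_relations_eq_gp_relations[OF _ _ eps_sign_hyperfield]) (simp_all add: sign_hyperfield_def)

lemma pluecker_relations_F2: "pluecker_relations F2 = gp_relations (null_sum F2)"
  by (rule pluecker_relations_eq_gp_relations) (unfold eps_F2, simp_all add: F2_def)

definition sign_valued :: "'e set \<Rightarrow> nat \<Rightarrow> ('e list \<Rightarrow> int) \<Rightarrow> bool" where
  "sign_valued E m \<phi> \<longleftrightarrow> (\<forall>xs \<in> tuples E m. \<phi> xs \<in> {0, 1, -1})"

lemma gp_terms_signed:
  assumes "sign_valued E w \<nu>" "sign_valued E r \<mu>"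
    and "ys \<in> tuples E (Suc w)" "set xs \<subseteq> E" "Suc (length xs) = r"
  shows "set_mset (gp_terms \<nu> \<mu> ys xs) \<subseteq> {0, 1, -1}"
proof
  fix t assume "t \<in># gp_terms \<nu> \<mu> ys xs"
  then obtain k where k: "k < Suc w" and t: "t = (-1) ^ Suc k * \<nu> (omit k ys) * \<mu> (ys ! k # xs)"
    using assms(3) unfolding gp_terms_def tuples_def by (auto simp del: power_Suc)
  have "omit k ys \<in> tuples E w" "ys ! k # xs \<in> tuples E r"
    using k assms(3-5) by (auto intro!: omit_in_tuples nth_Cons_in_tuples)
  then have "\<nu> (omit k ys) \<in> {0, 1, -1}" "\<mu> (ys ! k # xs) \<in> {0, 1, -1}"
    using assms(1,2) unfolding sign_valued_def by blast+
  moreover have "(-1::int) ^ Suc k \<in> {1, -1}" by (simp add: minus_one_power_iff)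
  ultimately show "t \<in> {0, 1, -1}" unfolding t by auto
qed

lemma gp_relations_signed_mono:
  assumes "gp_relations P E w \<nu> r \<mu>" "sign_valued E w \<nu>" "sign_valued E r \<mu>"
    and "\<And>S. set_mset S \<subseteq> {0, 1, -1} \<Longrightarrow> P S \<Longrightarrow> Q S"
  shows "gp_relations Q E w \<nu> r \<mu>"
  unfolding gp_relations_def
proof (intro ballI allI impI assms(4))
  fix ys xs assume "ys \<in> tuples E (Suc w)" "set xs \<subseteq> E \<and> Suc (length xs) = r"
  then show "set_mset (gp_terms \<nu> \<mu> ys xs) \<subseteq> {0, 1, -1}" "P (gp_terms \<nu> \<mu> ys xs)"
    using gp_terms_signed[OF assms(2,3)] assms(1) by (simp_all add: gp_relations_def)
qed

lemma gp_terms_of_int: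
  "gp_terms (\<lambda>zs. of_int (\<nu> zs)) (\<lambda>zs. of_int (\<mu> zs)) ys xs = image_mset of_int (gp_terms \<nu> \<mu> ys xs)"
  unfolding gp_terms_def mset_map multiset.map_comp by (intro image_mset_cong) (simp add: o_def)

lemma weak_gp_of_sign_hyperfield_F2:
  assumes sign: "gp_relations (null_sum sign_hyperfield) E w \<nu> r \<mu>" "sign_valued E w \<nu>" "sign_valued E r \<mu>"
    and F2: "gp_relations (null_sum F2) E w \<nu>\<^sub>2 r \<mu>\<^sub>2"
    and "\<And>zs. zs \<in> tuples E w \<Longrightarrow> \<nu>\<^sub>2 zs = of_int (\<nu> zs)" "\<And>zs. zs \<in> tuples E r \<Longrightarrow> \<mu>\<^sub>2 zs = of_int (\<mu> zs)"
  shows "weak_gp E w \<nu> r \<mu>"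
proof -
  have "gp_relations (null_sum F2) E w (\<lambda>zs. of_int (\<nu> zs)) r (\<lambda>zs. of_int (\<mu> zs))"
    using F2 assms(5,6) by (rule gp_relations_cong)
  then have "gp_relations (\<lambda>S. null_sum sign_hyperfield S \<and> null_sum F2 (image_mset of_int S)) E w \<nu> r \<mu>"
    using sign(1) by (simp add: gp_relations_def gp_terms_of_int)
  then show ?thesis by (rule gp_relations_signed_mono[OF _ sign(2,3)]) (auto intro: weakly_null_signs)
qed

lemma gp_functions_sign_hyperfield:
  assumes "\<phi> \<in> gp_functions sign_hyperfield E r"
  shows "sign_valued E r \<phi>" "alternating E r \<phi>" "gp_relations (null_sum sign_hyperfield) E r \<phi> r \<phi>"
proof -
  have simps: "tzero sign_hyperfield = 0" "monoid.mult sign_hyperfield = (*)" "carrier sign_hyperfield = {0, 1, -1}"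
    by (simp_all add: sign_hyperfield_def)
  show "sign_valued E r \<phi>"
    using gp_functions_carrier[OF assms] unfolding sign_valued_def simps by blast
  show "alternating E r \<phi>" "gp_relations (null_sum sign_hyperfield) E r \<phi> r \<phi>"
    using assms
    unfolding gp_functions_def alternating_def eps_sign_hyperfield pluecker_relations_sign_hyperfield simps
    by simp_all
qed

lemma gp_functions_F1pm_of_sign_hyperfield:
  assumes "\<phi> \<in> gp_functions sign_hyperfield E r" "pluecker_relations F1pm E r \<phi> r \<phi>"
  shows "\<phi> \<in> gp_functions F1pm E r"
proof -
  have "tzero sign_hyperfield = tzero F1pm" "monoid.mult sign_hyperfield = monoid.mult F1pm"
    "carrier sign_hyperfield = carrier F1pm"
    by (simp_all add: sign_hyperfield_def F1pm_def)
  then show ?thesis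
    using assms unfolding gp_functions_def eps_sign_hyperfield eps_F1pm by simp
qed

lemma support_matroid_eq_imp_of_int:
  assumes "support_matroid F2 E r \<phi>\<^sub>2 = support_matroid sign_hyperfield E r \<phi>"
    and "sign_valued E r \<phi>" "xs \<in> tuples E r"
  shows "\<phi>\<^sub>2 xs = of_int (\<phi> xs)"
proof -
  have "gp_support F2 E r \<phi>\<^sub>2 xs = gp_support sign_hyperfield E r \<phi> xs"
    using assms(1) by (simp add: support_matroid_def)
  then have "\<phi>\<^sub>2 xs = 0 \<longleftrightarrow> \<phi> xs = 0"
    using assms(3) by (simp add: gp_support_def to_krasner_def sign_hyperfield_def F2_def split: if_splits)
  moreover have "\<phi> xs \<in> {0, 1, -1}" using assms(2,3) unfolding sign_valued_def by blast
  ultimately show ?thesis by (cases "\<phi>\<^sub>2 xs") auto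
qed

lemma gp_flag_F1pm_of_sign_hyperfield_F2:
  assumes sign: "gp_flag sign_hyperfield E r \<mu> (Suc r) \<nu>" and F2: "gp_flag F2 E r \<mu>\<^sub>2 (Suc r) \<nu>\<^sub>2"
    and supp: "support_matroid F2 E r \<mu>\<^sub>2 = support_matroid sign_hyperfield E r \<mu>"
      "support_matroid F2 E (Suc r) \<nu>\<^sub>2 = support_matroid sign_hyperfield E (Suc r) \<nu>"
  shows "gp_flag F1pm E r \<mu> (Suc r) \<nu>"
proof -
  have gp: "\<mu> \<in> gp_functions sign_hyperfield E r" "\<nu> \<in> gp_functions sign_hyperfield E (Suc r)"
    "gp_relations (null_sum sign_hyperfield) E (Suc r) \<nu> r \<mu>"
    using sign by (simp_all add: gp_flag_def pluecker_relations_sign_hyperfield)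
  note \<mu> = gp_functions_sign_hyperfield[OF gp(1)] and \<nu> = gp_functions_sign_hyperfield[OF gp(2)]
  have rel\<^sub>2: "gp_relations (null_sum F2) E (Suc r) \<nu>\<^sub>2 (Suc r) \<nu>\<^sub>2" "gp_relations (null_sum F2) E (Suc r) \<nu>\<^sub>2 r \<mu>\<^sub>2"
    using F2 by (simp_all add: gp_flag_def gp_functions_def pluecker_relations_F2)
  note \<mu>\<^sub>2 = support_matroid_eq_imp_of_int[OF supp(1) \<mu>(1)]
    and \<nu>\<^sub>2 = support_matroid_eq_imp_of_int[OF supp(2) \<nu>(1)]
  have weak: "weak_gp E (Suc r) \<nu> (Suc r) \<nu>" "weak_gp E (Suc r) \<nu> r \<mu>"
    using weak_gp_of_sign_hyperfield_F2[OF \<nu>(3,1,1) rel\<^sub>2(1) \<nu>\<^sub>2 \<nu>\<^sub>2]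
      weak_gp_of_sign_hyperfield_F2[OF gp(3) \<nu>(1) \<mu>(1) rel\<^sub>2(2) \<nu>\<^sub>2 \<mu>\<^sub>2] by blast+
  obtain B where B: "B \<in> tuples E (Suc r)" "\<nu> B \<noteq> 0"
    using gp(2) by (auto simp: gp_functions_def sign_hyperfield_def)
  then have "\<nu> B * \<nu> B = 1" using \<nu>(1) by (auto simp: sign_valued_def)
  note strong = weak_gp_imp_strong_gp[OF \<nu>(2) \<mu>(2) weak B(1) this]
  have "pluecker_relations F1pm E m \<phi> k \<psi>"
    if "strong_gp E m \<phi> k \<psi>" "sign_valued E m \<phi>" "sign_valued E k \<psi>" for m k \<phi> \<psi>
    unfolding pluecker_relations_F1pm
    using that by (rule gp_relations_signed_mono) (simp add: null_sum_F1pm_iff)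
  then show ?thesis
    using strong gp(1,2) \<mu>(1) \<nu>(1) unfolding gp_flag_def
    by (auto intro: gp_functions_F1pm_of_sign_hyperfield)
qed

lemma representable_flag_F1pm_of_F2_sign_hyperfield:
  assumes rank: "flag_rank M = [r, r + 1]"
    and bin: "representable_flag F2 E M" and ori: "representable_flag sign_hyperfield E M"
  shows "representable_flag F1pm E M"
proof -
  obtain \<mu>\<^sub>2 \<nu>\<^sub>2 where F2: "gp_flag F2 E r \<mu>\<^sub>2 (Suc r) \<nu>\<^sub>2"
    and M_F2: "M = [support_matroid F2 E r \<mu>\<^sub>2, support_matroid F2 E (Suc r) \<nu>\<^sub>2]"
    using bin unfolding tract.representable_flag_iff[OF tract_F2 rank] by auto
  obtain \<mu> \<nu> where sign: "gp_flag sign_hyperfield E r \<mu> (Suc r) \<nu>"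
    and M_sign: "M = [support_matroid sign_hyperfield E r \<mu>, support_matroid sign_hyperfield E (Suc r) \<nu>]"
    using ori unfolding tract.representable_flag_iff[OF tract_sign_hyperfield rank] by auto
  have "gp_flag F1pm E r \<mu> (Suc r) \<nu>"
    using gp_flag_F1pm_of_sign_hyperfield_F2[OF sign F2] M_F2 M_sign by simp
  moreover have "support_matroid F1pm E m \<phi> = support_matroid sign_hyperfield E m \<phi>" for m \<phi>
    by (simp add: support_matroid_def gp_support_def to_krasner_def F1pm_def sign_hyperfield_def)
  ultimately show ?thesis
    unfolding tract.representable_flag_iff[OF tract_F1pm rank] using M_sign by auto
qed

theorem theoremF:
  fixes n r :: nat and M :: "(nat, nat) coeff_matroid list"
  assumes "flag_matroid krasner {1..n} M"
    and "flag_rank M = [r, r + 1]"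
  shows "regular_flag {1..n} M \<longleftrightarrow> binary_flag {1..n} M \<and> orientable_flag {1..n} M"
  unfolding regular_flag_def binary_flag_def orientable_flag_def representable_flag_def[symmetric]
proof
  assume "representable_flag F1pm {1..n} M"
  then show "representable_flag F2 {1..n} M \<and> representable_flag sign_hyperfield {1..n} M"
    using tract_morphism.representable_flag_push_forward[OF tract_morphism_F1pm_F2 assms(2)]
      tract_morphism.representable_flag_push_forward[OF tract_morphism_F1pm_sign_hyperfield assms(2)]
    by blast
next
  assume "representable_flag F2 {1..n} M \<and> representable_flag sign_hyperfield {1..n} M"
  then show "representable_flag F1pm {1..n} M"
    using representable_flag_F1pm_of_F2_sign_hyperfield[OF assms(2)] by blast
qed

end
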